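(* Let $m,n,k$ be non-negative integers with $1\le k\le n$ and let $b_{n-k+1},\dots,b_n$ be positive integers. The sum over all $(m,n,k)$-Magog trapezoids with bottom row $(b_{n-k+1},\dots,b_n)$ of $P^{\#\text{maxima}}Q^{\#\text{minima not including }b_{n-k+1}}$ equals the constant term in $x_1,\dots,x_n$ of $$(-1)^{(m-1)n+\binom{n+1}{2}+\sum_{i=n-k+1}^nb_i}\prod_{i=1}^{n-k}(1+x_i)^{-i-k}x_i^{-m-2n+i+1}\bigl(x_i-P(1+x_i)\bigr)\bigl(x_i-Q(1+x_i)\bigr)$$ $$\times\prod_{i=n-k+1}^n(1+x_i)^{-n}x_i^{-m-2n+b_i+i}\bigl(x_i-P(1+x_i)\bigr)\prod_{1\le i<j\le n}(x_i-x_j)(x_i+x_j+x_ix_j).$$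
   Context: For non-negative integers $m,n,k$ with $k\le n$, an $(m,n,k)$-Magog trapezoid is an array $(m_{i,j})$ of positive integers indexed by $1\le j\le i\le n$ with $i-j\le k-1$ (the $k$ rightmost SE-diagonals of a triangular array with $n$ rows, row $i$ on top of row $i+1$, $m_{i,j}$ between $m_{i+1,j}$ and $m_{i+1,j+1}$), such that $m_{i+1,j}\le m_{i,j}\le m_{i+1,j+1}$ whenever these entries exist (weak increase along NE- and SE-diagonals) and $m_{i,j}\le m+j$ (entries of the $j$-th NE-diagonal from the left are bounded by $m+j$). Its bottom row is $(b_{n-k+1},\dots,b_n)=(m_{n,n-k+1},\dots,m_{n,n})$. A minimum is an entry equal to $1$ in the leftmost SE-diagonal $\{m_{i,j}:i-j=k-1\}$; a maximum is an entry $m_{j,j}$ of the rightmost SE-diagonal with $m_{j,j}=m+j$. "Minima not including $b_{n-k+1}$" means the bottom entry $m_{n,n-k+1}$ is not counted. $P,Q$ are indeterminates; negative powers of $(1+x_i)$ are expanded as power series in $x_i$.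
   Formalization: The bottom row is additionally assumed weakly increasing, as every Magog trapezoid's bottom row is; without this the claim fails, e.g. m=1, n=k=2, b=(3,1): the sum is empty (0), but the constant term is -P. *)

theory Defs
  imports Complex_Main "HOL-Library.Poly_Mapping"
begin

section \<open>Magog trapezoids\<close>

text \<open>
  Rows are indexed by \<open>i\<close> (row \<open>1\<close> on top) and NE-diagonals by \<open>j\<close>. The condition
  \<open>i - j \<le> k - 1\<close> on integers is written \<open>i < j + k\<close> to avoid truncated subtraction.
\<close>

definition magog_index :: "nat \<Rightarrow> nat \<Rightarrow> (nat \<times> nat) set" where
  "magog_index n k = {(i, j). 1 \<le> j \<and> j \<le> i \<and> i \<le> n \<and> i < j + k}"

text \<open>
  An array is a function on all of \<open>nat \<times> nat\<close>, normalised to \<open>0\<close> off the index set, so that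
  distinct functions are distinct arrays.
\<close>

definition magog_trapezoids :: "nat \<Rightarrow> nat \<Rightarrow> nat \<Rightarrow> (nat \<Rightarrow> nat \<Rightarrow> nat) set" where
  "magog_trapezoids m n k = {M.
     (\<forall>i j. (i, j) \<notin> magog_index n k \<longrightarrow> M i j = 0) \<and>
     (\<forall>i j. (i, j) \<in> magog_index n k \<longrightarrow> 0 < M i j \<and> M i j \<le> m + j) \<and>
     (\<forall>i j. (i, j) \<in> magog_index n k \<and> (i + 1, j) \<in> magog_index n k
        \<longrightarrow> M (i + 1) j \<le> M i j) \<and>
     (\<forall>i j. (i, j) \<in> magog_index n k \<and> (i + 1, j + 1) \<in> magog_index n k
        \<longrightarrow> M i j \<le> M (i + 1) (j + 1))}"

definition magog_maxima ::
    "nat \<Rightarrow> nat \<Rightarrow> nat \<Rightarrow> (nat \<Rightarrow> nat \<Rightarrow> nat) \<Rightarrow> (nat \<times> nat) set" where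
  "magog_maxima m n k M = {(i, j) \<in> magog_index n k. i = j \<and> M i j = m + j}"

text \<open>The leftmost SE-diagonal is \<open>i - j = k - 1\<close>, that is, \<open>i + 1 = j + k\<close>.\<close>

definition magog_minima ::
    "nat \<Rightarrow> nat \<Rightarrow> (nat \<Rightarrow> nat \<Rightarrow> nat) \<Rightarrow> (nat \<times> nat) set" where
  "magog_minima n k M = {(i, j) \<in> magog_index n k. i + 1 = j + k \<and> M i j = 1}"

lemma finite_magog_index: "finite (magog_index n k)"
  by (rule finite_subset[of _ "{..n} \<times> {..n}"]) (auto simp: magog_index_def)

lemma finite_magog_trapezoids: "finite (magog_trapezoids m n k)"
proof -
  let ?F = "{f. \<forall>x. (x \<in> magog_index n k \<longrightarrow> f x \<in> {..m + n}) \<and>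
                     (x \<notin> magog_index n k \<longrightarrow> f x = (0::nat))}"
  have "finite ?F"
    by (rule finite_set_of_finite_funs) (auto simp: finite_magog_index)
  moreover have "magog_trapezoids m n k \<subseteq> curry ` ?F"
  proof
    fix M assume M: "M \<in> magog_trapezoids m n k"
    have "M i j \<le> m + n" if "(i, j) \<in> magog_index n k" for i j
    proof -
      have "M i j \<le> m + j" using M that by (simp add: magog_trapezoids_def)
      moreover have "j \<le> n" using that by (simp add: magog_index_def)
      ultimately show ?thesis by simp
    qed
    moreover have "M i j = 0" if "(i, j) \<notin> magog_index n k" for i j
      using M that by (simp add: magog_trapezoids_def)
    ultimately have "case_prod M \<in> ?F" by simp
    then show "M \<in> curry ` ?F"
      by (metis (no_types, lifting) curry_case_prod image_eqI)
  qed
  ultimately show ?thesis by (meson finite_imageI finite_subset)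
qed

text \<open>
  A bottom row is always weakly increasing. For other prescribed rows there is no trapezoid, whereas
  a constant term that is antisymmetric in the numbers \<open>b\<^sub>i + i\<close> (for \<open>k = n\<close>) need not vanish.
\<close>

lemma magog_bottom_row_mono:
  assumes M: "M \<in> magog_trapezoids m n k" and k: "k \<le> n" and i: "i \<in> {n - k + 1..<n}"
  shows "M n i \<le> M n (i + 1)"
proof -
  obtain r where n: "n = r + 1" using i by (cases n) auto
  have "(r, i) \<in> magog_index n k" "(r + 1, i) \<in> magog_index n k"
    "(r + 1, i + 1) \<in> magog_index n k"
    using i k n by (auto simp: magog_index_def)
  then have "M (r + 1) i \<le> M r i" "M r i \<le> M (r + 1) (i + 1)"
    using M unfolding magog_trapezoids_def by blast+
  then show ?thesis using n by (metis order_trans)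
qed


section \<open>Formal Laurent series in finitely many of the variables \<open>x\<^sub>0, x\<^sub>1, \<dots>\<close>\<close>

text \<open>
  Exponent vectors are finitely supported functions \<open>nat \<Rightarrow>\<^sub>0 int\<close>. A series may involve only
  finitely many variables, and its exponents must be bounded below; both are expressed by one
  natural number \<open>N\<close>.
\<close>

definition exps :: "nat \<Rightarrow> (nat \<Rightarrow>\<^sub>0 int) set" where
  "exps N = {e. \<forall>i. - int N \<le> Poly_Mapping.lookup e i \<and> (N \<le> i \<longrightarrow> Poly_Mapping.lookup e i = 0)}"

lemma exps_mono: "N \<le> K \<Longrightarrow> exps N \<subseteq> exps K"
  unfolding exps_def by (smt (verit, best) Collect_mono of_nat_mono order_trans)

lemma exps_add: "a \<in> exps N \<Longrightarrow> b \<in> exps K \<Longrightarrow> a + b \<in> exps (N + K)"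
  unfolding exps_def
proof clarify
  fix i
  assume "\<forall>i. - int N \<le> Poly_Mapping.lookup a i \<and> (N \<le> i \<longrightarrow> Poly_Mapping.lookup a i = 0)"
    and "\<forall>i. - int K \<le> Poly_Mapping.lookup b i \<and> (K \<le> i \<longrightarrow> Poly_Mapping.lookup b i = 0)"
  then have "- int N \<le> Poly_Mapping.lookup a i \<and> (N \<le> i \<longrightarrow> Poly_Mapping.lookup a i = 0)"
    and "- int K \<le> Poly_Mapping.lookup b i \<and> (K \<le> i \<longrightarrow> Poly_Mapping.lookup b i = 0)" by blast+
  then show "- int (N + K) \<le> Poly_Mapping.lookup (a + b) i \<and>
      (N + K \<le> i \<longrightarrow> Poly_Mapping.lookup (a + b) i = 0)"
    by (auto simp: lookup_add)
qed

lemma exps_exhaust: "\<exists>N. e \<in> exps N"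
proof -
  have fin: "finite (Poly_Mapping.keys e)" by simp
  define N where "N = Suc (Max (insert 0 (Poly_Mapping.keys e))) +
    (\<Sum>i\<in>Poly_Mapping.keys e. nat \<bar>Poly_Mapping.lookup e i\<bar>)"
  have "- int N \<le> Poly_Mapping.lookup e i \<and> (N \<le> i \<longrightarrow> Poly_Mapping.lookup e i = 0)" for i
  proof (cases "i \<in> Poly_Mapping.keys e")
    case True
    have "i \<le> Max (insert 0 (Poly_Mapping.keys e))" using True fin by simp
    moreover have "nat \<bar>Poly_Mapping.lookup e i\<bar> \<le> (\<Sum>i\<in>Poly_Mapping.keys e. nat \<bar>Poly_Mapping.lookup e i\<bar>)"
      by (rule member_le_sum) (use True in auto)
    ultimately show ?thesis unfolding N_def by linarith
  next
    case False
    then show ?thesis by (simp add: in_keys_iff)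
  qed
  then show ?thesis unfolding exps_def by blast
qed

lemma finite_exps_pairs: "finite {a \<in> exps N. e - a \<in> exps N}" (is "finite ?A")
proof -
  obtain K where K: "\<And>i. Poly_Mapping.lookup e i \<le> int K"
  proof -
    obtain K where "- e \<in> exps K" using exps_exhaust by blast
    then have "- int K \<le> - Poly_Mapping.lookup e i" for i by (simp add: exps_def)
    then have "Poly_Mapping.lookup e i \<le> int K" for i by (metis neg_le_iff_le)
    then show ?thesis using that by blast
  qed
  let ?F = "{f. \<forall>i. (i \<in> {..<N} \<longrightarrow> f i \<in> {- int N..int K + int N}) \<and>
                     (i \<notin> {..<N} \<longrightarrow> f i = (0::int))}"
  have "finite ?F" by (rule finite_set_of_finite_funs) auto
  moreover have "Poly_Mapping.lookup ` ?A \<subseteq> ?F"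
  proof (clarify, intro conjI impI)
    fix a i assume a: "a \<in> exps N" "e - a \<in> exps N"
    show "Poly_Mapping.lookup a i \<in> {- int N..int K + int N}"
    proof -
      have "- int N \<le> Poly_Mapping.lookup a i" "- int N \<le> Poly_Mapping.lookup e i - Poly_Mapping.lookup a i"
        using a by (simp_all add: exps_def lookup_minus)
      then show ?thesis using K[of i] by simp
    qed
    assume "i \<notin> {..<N}"
    then show "Poly_Mapping.lookup a i = 0" using a by (simp add: exps_def)
  qed
  ultimately have "finite (Poly_Mapping.lookup ` ?A)" by (rule rev_finite_subset)
  moreover have "inj_on Poly_Mapping.lookup ?A" by (simp add: inj_on_def poly_mapping_eqI)
  ultimately show ?thesis by (rule finite_imageD)
qed

typedef (overloaded) 'a mfls =
    "{f :: (nat \<Rightarrow>\<^sub>0 int) \<Rightarrow> 'a :: zero. \<exists>N. \<forall>e. f e \<noteq> 0 \<longrightarrow> e \<in> exps N}"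
  morphisms mfls_coeff Abs_mfls
  by (rule exI[of _ "\<lambda>_. 0"]) simp

lemma mfls_bound: obtains N where "\<And>e K. N \<le> K \<Longrightarrow> mfls_coeff f e \<noteq> 0 \<Longrightarrow> e \<in> exps K"
  using mfls_coeff[of f] exps_mono by blast

lemma mfls_eqI: "(\<And>e. mfls_coeff f e = mfls_coeff g e) \<Longrightarrow> f = g"
  by (simp add: mfls_coeff_inject[symmetric] fun_eq_iff)

text \<open>The series with the single term \<open>c\<close> times the monomial with exponent vector \<open>e\<close>.\<close>

definition mfls_monom :: "(nat \<Rightarrow>\<^sub>0 int) \<Rightarrow> 'a \<Rightarrow> 'a :: zero mfls" where
  "mfls_monom e c = Abs_mfls (\<lambda>e'. if e' = e then c else 0)"

lemma mfls_coeff_monom: "mfls_coeff (mfls_monom e c) = (\<lambda>e'. if e' = e then c else 0)"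
proof -
  obtain N where "e \<in> exps N" using exps_exhaust by blast
  then show ?thesis unfolding mfls_monom_def by (subst Abs_mfls_inverse) auto
qed

instantiation mfls :: (comm_ring_1) comm_ring_1
begin

definition zero_mfls :: "'a mfls" where "zero_mfls = Abs_mfls (\<lambda>_. 0)"

lemma mfls_coeff_zero: "mfls_coeff 0 e = (0 :: 'a)"
  by (simp add: zero_mfls_def Abs_mfls_inverse)

definition one_mfls :: "'a mfls" where "one_mfls = mfls_monom 0 1"

definition uminus_mfls :: "'a mfls \<Rightarrow> 'a mfls" where
  "uminus_mfls f = Abs_mfls (\<lambda>e. - mfls_coeff f e)"

lemma mfls_coeff_uminus: "mfls_coeff (- f) e = - (mfls_coeff f e :: 'a)"
  unfolding uminus_mfls_def using mfls_coeff[of f] by (subst Abs_mfls_inverse) auto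

definition plus_mfls :: "'a mfls \<Rightarrow> 'a mfls \<Rightarrow> 'a mfls" where
  "plus_mfls f g = Abs_mfls (\<lambda>e. mfls_coeff f e + mfls_coeff g e)"

lemma mfls_coeff_plus: "mfls_coeff (f + g) e = mfls_coeff f e + (mfls_coeff g e :: 'a)"
proof -
  obtain N where N: "\<And>e K. N \<le> K \<Longrightarrow> mfls_coeff f e \<noteq> 0 \<Longrightarrow> e \<in> exps K" by (rule mfls_bound) blast
  obtain K where K: "\<And>e L. K \<le> L \<Longrightarrow> mfls_coeff g e \<noteq> 0 \<Longrightarrow> e \<in> exps L" by (rule mfls_bound) blast
  have "e \<in> exps (N + K)" if "mfls_coeff f e + mfls_coeff g e \<noteq> 0" for e
  proof -
    from that have "mfls_coeff f e \<noteq> 0 \<or> mfls_coeff g e \<noteq> 0" by auto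
    then show ?thesis using N[of "N + K"] K[of "N + K"] by auto
  qed
  then show ?thesis unfolding plus_mfls_def by (subst Abs_mfls_inverse) blast+
qed

definition minus_mfls :: "'a mfls \<Rightarrow> 'a mfls \<Rightarrow> 'a mfls" where "minus_mfls f g = f + (- g)"

definition times_mfls :: "'a mfls \<Rightarrow> 'a mfls \<Rightarrow> 'a mfls" where
  "times_mfls f g = Abs_mfls (\<lambda>e.
     \<Sum>a | mfls_coeff f a \<noteq> 0 \<and> mfls_coeff g (e - a) \<noteq> 0. mfls_coeff f a * mfls_coeff g (e - a))"

lemma mfls_coeff_times_supp:
  "mfls_coeff (f * g) e =
    (\<Sum>a | mfls_coeff f a \<noteq> 0 \<and> mfls_coeff g (e - a) \<noteq> 0.
        mfls_coeff f a * (mfls_coeff g (e - a) :: 'a))"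
proof -
  obtain N where N: "\<And>e. mfls_coeff f e \<noteq> 0 \<Longrightarrow> e \<in> exps N" using mfls_coeff[of f] by blast
  obtain K where K: "\<And>e. mfls_coeff g e \<noteq> 0 \<Longrightarrow> e \<in> exps K" using mfls_coeff[of g] by blast
  have "e \<in> exps (N + K)"
    if "(\<Sum>a | mfls_coeff f a \<noteq> 0 \<and> mfls_coeff g (e - a) \<noteq> 0.
            mfls_coeff f a * mfls_coeff g (e - a)) \<noteq> 0" for e
  proof -
    from that obtain a where "mfls_coeff f a \<noteq> 0" "mfls_coeff g (e - a) \<noteq> 0"
      by (metis (mono_tags, lifting) mem_Collect_eq sum.neutral)
    then have "a + (e - a) \<in> exps (N + K)" using N K exps_add by blast
    then show ?thesis by simp
  qed
  then show ?thesis unfolding times_mfls_def by (subst Abs_mfls_inverse) blast+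
qed

lemma mfls_coeff_times:
  assumes "\<And>e. mfls_coeff f e \<noteq> 0 \<Longrightarrow> e \<in> exps N" "\<And>e. mfls_coeff g e \<noteq> 0 \<Longrightarrow> e \<in> exps N"
  shows "mfls_coeff (f * g) e =
    (\<Sum>a \<in> {a \<in> exps N. e - a \<in> exps N}. mfls_coeff f a * mfls_coeff g (e - a))"
  unfolding mfls_coeff_times_supp
proof (rule sum.mono_neutral_left[OF finite_exps_pairs])
  show "{a. mfls_coeff f a \<noteq> 0 \<and> mfls_coeff g (e - a) \<noteq> 0} \<subseteq> {a \<in> exps N. e - a \<in> exps N}"
    using assms by blast
qed auto

lemma mfls_coeff_monom_times: "mfls_coeff (mfls_monom a c * f) e = c * mfls_coeff f (e - a)"
proof (cases "c = 0 \<or> mfls_coeff f (e - a) = 0")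
  case True
  have "{x. (if x = a then c else 0) \<noteq> 0 \<and> mfls_coeff f (e - x) \<noteq> 0} = {}"
    using True by auto
  then show ?thesis using True by (auto simp: mfls_coeff_times_supp mfls_coeff_monom)
next
  case False
  then have "{x. (if x = a then c else 0) \<noteq> 0 \<and> mfls_coeff f (e - x) \<noteq> 0} = {a}"
    by auto
  then show ?thesis by (simp add: mfls_coeff_times_supp mfls_coeff_monom)
qed

instance
proof
  fix f g h :: "'a mfls"
  show "f + g + h = f + (g + h)" by (rule mfls_eqI) (simp add: mfls_coeff_plus add.assoc)
  show "f + g = g + f" by (rule mfls_eqI) (simp add: mfls_coeff_plus add.commute)
  show "0 + f = f" by (rule mfls_eqI) (simp add: mfls_coeff_plus mfls_coeff_zero)
  show "- f + f = 0" by (rule mfls_eqI) (simp add: mfls_coeff_plus mfls_coeff_uminus mfls_coeff_zero)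
  show "f - g = f + - g" by (rule minus_mfls_def)
  show comm: "f * g = g * f" for f g :: "'a mfls"
  proof (rule mfls_eqI)
    fix e
    show "mfls_coeff (f * g) e = mfls_coeff (g * f) e"
      unfolding mfls_coeff_times_supp
      by (rule sum.reindex_bij_witness[where i = "\<lambda>a. e - a" and j = "\<lambda>a. e - a"])
         (auto simp: mult.commute)
  qed
  show "1 * f = f"
    by (rule mfls_eqI) (simp add: one_mfls_def mfls_coeff_monom_times)
  show "(0::'a mfls) \<noteq> 1"
  proof
    assume "(0::'a mfls) = 1"
    then have "mfls_coeff (0::'a mfls) 0 = mfls_coeff 1 0" by simp
    then show False by (simp add: mfls_coeff_zero one_mfls_def mfls_coeff_monom)
  qed
  obtain N1 where N1: "\<And>e K. N1 \<le> K \<Longrightarrow> mfls_coeff f e \<noteq> 0 \<Longrightarrow> e \<in> exps K" by (rule mfls_bound) blast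
  obtain N2 where N2: "\<And>e K. N2 \<le> K \<Longrightarrow> mfls_coeff g e \<noteq> 0 \<Longrightarrow> e \<in> exps K" by (rule mfls_bound) blast
  obtain N3 where N3: "\<And>e K. N3 \<le> K \<Longrightarrow> mfls_coeff h e \<noteq> 0 \<Longrightarrow> e \<in> exps K" by (rule mfls_bound) blast
  obtain N4 where N4: "\<And>e K. N4 \<le> K \<Longrightarrow> mfls_coeff (f * g) e \<noteq> 0 \<Longrightarrow> e \<in> exps K" by (rule mfls_bound) blast
  obtain N5 where N5: "\<And>e K. N5 \<le> K \<Longrightarrow> mfls_coeff (g * h) e \<noteq> 0 \<Longrightarrow> e \<in> exps K" by (rule mfls_bound) blast
  obtain N6 where N6: "\<And>e K. N6 \<le> K \<Longrightarrow> mfls_coeff (f + g) e \<noteq> 0 \<Longrightarrow> e \<in> exps K" by (rule mfls_bound) blast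
  define N where "N = N1 + N2 + N3 + N4 + N5 + N6"
  define K where "K = N + N"
  have le: "N1 \<le> K" "N2 \<le> K" "N3 \<le> K" "N4 \<le> K" "N5 \<le> K" "N6 \<le> K" "N \<le> K"
    by (simp_all add: K_def N_def)
  note leK = N1[OF le(1)] N2[OF le(2)] N3[OF le(3)] N4[OF le(4)] N5[OF le(5)] N6[OF le(6)]
  have leN: "mfls_coeff f e \<noteq> 0 \<Longrightarrow> e \<in> exps N" "mfls_coeff g e \<noteq> 0 \<Longrightarrow> e \<in> exps N"
    "mfls_coeff h e \<noteq> 0 \<Longrightarrow> e \<in> exps N" for e
    by (rule N1 N2 N3; simp add: N_def)+
  show "(f + g) * h = f * h + g * h"
  proof (rule mfls_eqI)
    fix e
    have "mfls_coeff ((f + g) * h) e =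
        (\<Sum>a \<in> {a \<in> exps K. e - a \<in> exps K}. mfls_coeff (f + g) a * mfls_coeff h (e - a))"
      by (rule mfls_coeff_times; fact leK)
    then show "mfls_coeff ((f + g) * h) e = mfls_coeff (f * h + g * h) e"
      by (simp add: mfls_coeff_times[OF leK(1) leK(3)]
          mfls_coeff_times[OF leK(2) leK(3)] mfls_coeff_plus sum.distrib distrib_right)
  qed
  show "f * g * h = f * (g * h)"
  proof (rule mfls_eqI)
    fix e
    have fg_h: "mfls_coeff (f * g * h) e =
        (\<Sum>c \<in> {c \<in> exps K. e - c \<in> exps K}. mfls_coeff (f * g) c * mfls_coeff h (e - c))" for e
      by (rule mfls_coeff_times; fact leK)
    have fg: "mfls_coeff (f * g) e =
        (\<Sum>a \<in> {a \<in> exps K. e - a \<in> exps K}. mfls_coeff f a * mfls_coeff g (e - a))" for e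
      by (rule mfls_coeff_times; fact leK)
    have f_gh: "mfls_coeff (f * (g * h)) e =
        (\<Sum>a \<in> {a \<in> exps K. e - a \<in> exps K}. mfls_coeff f a * mfls_coeff (g * h) (e - a))" for e
      by (rule mfls_coeff_times; fact leK)
    have gh: "mfls_coeff (g * h) e =
        (\<Sum>a \<in> {a \<in> exps K. e - a \<in> exps K}. mfls_coeff g a * mfls_coeff h (e - a))" for e
      by (rule mfls_coeff_times; fact leK)
    define A where "A = (\<lambda>e. {a \<in> exps K. e - a \<in> exps K})"
    have fin: "finite (A e)" for e unfolding A_def by (rule finite_exps_pairs)
    let ?f = "mfls_coeff f" and ?g = "mfls_coeff g" and ?h = "mfls_coeff h"
    let ?S = "SIGMA c:A e. A c" and ?T = "SIGMA a:A e. A (e - a)"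
    let ?S_zero = "{p \<in> ?S. (case p of (c, a) \<Rightarrow> ?f a * ?g (c - a) * ?h (e - c)) = 0}"
    let ?T_zero = "{p \<in> ?T. (case p of (a, b) \<Rightarrow> ?f a * (?g b * ?h (e - a - b))) = 0}"
    have "mfls_coeff (f * g * h) e = (\<Sum>c\<in>A e. (\<Sum>a\<in>A c. ?f a * ?g (c - a)) * ?h (e - c))"
      unfolding A_def fg_h fg ..
    also have "\<dots> = (\<Sum>(c, a)\<in>(SIGMA c:A e. A c). ?f a * ?g (c - a) * ?h (e - c))"
      using fin by (simp add: sum_distrib_right sum.Sigma)
    also have "\<dots> = (\<Sum>(a, b)\<in>?T. ?f a * (?g b * ?h (e - a - b)))"
    proof (rule sum.reindex_bij_witness_not_neutral[where
          S' = ?S_zero and T' = ?T_zero and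
          i = "\<lambda>(a, b). (a + b, a)" and j = "\<lambda>(c, a). (a, c - a)"])
      show "finite ?S_zero"
        using fin by auto
      show "finite ?T_zero"
        using fin by auto
    next
      fix p assume p: "p \<in> ?S - ?S_zero"
      obtain c a where [simp]: "p = (c, a)" by (cases p)
      have nz: "?f a * ?g (c - a) * ?h (e - c) \<noteq> 0" using p by auto
      then have *: "a \<in> exps N" "c - a \<in> exps N" "e - c \<in> exps N"
        using leN by (metis mult_zero_left mult_zero_right)+
      have "e - a \<in> exps K" using exps_add[OF *(2,3)] by (simp add: K_def)
      moreover have "a \<in> exps K" "c - a \<in> exps K" "e - c \<in> exps K"
        using * exps_mono[OF le(7)] by blast+
      ultimately have "(a, c - a) \<in> ?T"
        by (simp add: A_def)
      then show "(case p of (c, a) \<Rightarrow> (a, c - a)) \<in> ?T - ?T_zero"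
        using nz by (simp add: mult.assoc diff_diff_eq)
      show "(case case p of (c, a) \<Rightarrow> (a, c - a) of (a, b) \<Rightarrow> (a + b, a)) = p" by simp
    next
      fix p assume p: "p \<in> ?T - ?T_zero"
      obtain a b where [simp]: "p = (a, b)" by (cases p)
      have nz: "?f a * (?g b * ?h (e - a - b)) \<noteq> 0" using p by auto
      then have *: "a \<in> exps N" "b \<in> exps N" "e - a - b \<in> exps N"
        using leN by (metis mult_zero_left mult_zero_right)+
      have "a + b \<in> exps K" using exps_add[OF *(1,2)] by (simp add: K_def)
      moreover have "a \<in> exps K" "b \<in> exps K" "e - (a + b) \<in> exps K"
        using * exps_mono[OF le(7)] by (auto simp: diff_diff_eq)
      ultimately have "(a + b, a) \<in> ?S"
        by (simp add: A_def)
      then show "(case p of (a, b) \<Rightarrow> (a + b, a)) \<in> ?S - ?S_zero"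
        using nz by (simp add: mult.assoc diff_diff_eq)
      show "(case case p of (a, b) \<Rightarrow> (a + b, a) of (c, a) \<Rightarrow> (a, c - a)) = p" by simp
    next
      fix p assume "p \<in> ?S"
      show "(case case p of (c, a) \<Rightarrow> (a, c - a) of (a, b) \<Rightarrow> ?f a * (?g b * ?h (e - a - b))) =
          (case p of (c, a) \<Rightarrow> ?f a * ?g (c - a) * ?h (e - c))"
        by (cases p) (simp add: mult.assoc diff_diff_eq)
    qed auto
    also have "\<dots> = (\<Sum>a\<in>A e. ?f a * (\<Sum>b\<in>A (e - a). ?g b * ?h (e - a - b)))"
      using fin by (simp add: sum_distrib_left sum.Sigma)
    also have "\<dots> = mfls_coeff (f * (g * h)) e"
      unfolding A_def f_gh gh ..
    finally show "mfls_coeff (f * g * h) e = mfls_coeff (f * (g * h)) e" .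
  qed
qed

end

text \<open>
  The inverse of a unit (and \<open>0\<close> for non-units), which makes the integer powers \<open>f powi z\<close>
  available. As exponents are bounded below, the inverse of \<open>1 + x\<^sub>i\<close> can only be its expansion as
  a power series in \<open>x\<^sub>i\<close>; see \<open>mfls_inverse_one_plus_var\<close>.
\<close>

instantiation mfls :: (comm_ring_1) inverse
begin

definition inverse_mfls :: "'a mfls \<Rightarrow> 'a mfls" where
  "inverse_mfls f = (if f dvd 1 then THE g. f * g = 1 else 0)"

definition divide_mfls :: "'a mfls \<Rightarrow> 'a mfls \<Rightarrow> 'a mfls" where
  "divide_mfls f g = f * inverse g"

instance ..

end

lemma mfls_inverse_eqI:
  fixes f g :: "'a :: comm_ring_1 mfls"
  assumes "f * g = 1"
  shows "inverse f = g"
proof -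
  have "(THE g. f * g = 1) = g"
    using assms by (intro the_equality) (auto, metis mult.assoc mult.commute mult_1)
  moreover have "f dvd 1" using assms by (metis dvd_triv_left)
  ultimately show ?thesis by (simp add: inverse_mfls_def)
qed

definition mfls_const :: "'a \<Rightarrow> 'a :: zero mfls" where
  "mfls_const c = mfls_monom 0 c"

definition mfls_var :: "nat \<Rightarrow> 'a :: {zero, one} mfls" where
  "mfls_var i = mfls_monom (Poly_Mapping.single i 1) 1"

definition const_term :: "'a :: zero mfls \<Rightarrow> 'a" where
  "const_term f = mfls_coeff f 0"

lemma mfls_monom_mult:
  "mfls_monom a c * mfls_monom b d = mfls_monom (a + b) (c * d :: 'a :: comm_ring_1)"
  by (rule mfls_eqI) (auto simp: mfls_coeff_monom_times mfls_coeff_monom algebra_simps)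

lemma mfls_var_powi:
  "mfls_var i powi z = (mfls_monom (Poly_Mapping.single i z) 1 :: 'a :: comm_ring_1 mfls)"
proof -
  have pow: "mfls_monom (Poly_Mapping.single i c) 1 ^ r
      = (mfls_monom (Poly_Mapping.single i (int r * c)) 1 :: 'a mfls)" for c :: int and r
    by (induction r) (simp_all add: one_mfls_def mfls_monom_mult single_add[symmetric] algebra_simps)
  have "inverse (mfls_var i) = (mfls_monom (Poly_Mapping.single i (-1)) 1 :: 'a mfls)"
    by (rule mfls_inverse_eqI)
       (simp add: mfls_var_def mfls_monom_mult single_add[symmetric] one_mfls_def)
  then show ?thesis by (auto simp: power_int_def pow mfls_var_def)
qed

lemma mfls_inverse_minus_one: "inverse (- 1) = (- 1 :: 'a :: comm_ring_1 mfls)"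
  by (rule mfls_inverse_eqI) simp

lemma mfls_inverse_one_plus_var:
  "mfls_coeff (inverse (1 + mfls_var i)) e =
     (if \<exists>r. e = Poly_Mapping.single i (int r)
      then (-1 :: 'a :: comm_ring_1) ^ nat (Poly_Mapping.lookup e i) else 0)"
proof -
  define c :: "(nat \<Rightarrow>\<^sub>0 int) \<Rightarrow> 'a" where
    "c = (\<lambda>e. if \<exists>r. e = Poly_Mapping.single i (int r) then (-1) ^ nat (Poly_Mapping.lookup e i) else 0)"
  define g where "g = Abs_mfls c"
  have "e \<in> exps (Suc i)" if "c e \<noteq> 0" for e
    using that by (auto simp: c_def exps_def lookup_single when_def split: if_splits)
  then have g: "mfls_coeff g = c" unfolding g_def by (subst Abs_mfls_inverse) blast+
  have "(1 + mfls_var i) * g = 1"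
  proof (rule mfls_eqI)
    fix e
    have "mfls_coeff ((1 + mfls_var i) * g) e = c e + c (e - Poly_Mapping.single i 1)"
      by (simp add: distrib_right mfls_coeff_plus mfls_var_def mfls_coeff_monom_times g)
    also have "\<dots> = mfls_coeff 1 e"
    proof (cases "\<exists>r. e = Poly_Mapping.single i (int r)")
      case True
      then obtain r where e: "e = Poly_Mapping.single i (int r)" by blast
      have shift: "e - Poly_Mapping.single i 1 = Poly_Mapping.single i (int r - 1)"
        unfolding e by (simp add: single_diff)
      show ?thesis
      proof (cases r)
        case 0
        have "\<nexists>s. Poly_Mapping.single i (int r - 1) = Poly_Mapping.single i (int s)"
        proof
          assume "\<exists>s. Poly_Mapping.single i (int r - 1) = Poly_Mapping.single i (int s)"
          then obtain s where "Poly_Mapping.lookup (Poly_Mapping.single i (int r - 1)) i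
              = Poly_Mapping.lookup (Poly_Mapping.single i (int s)) i" by metis
          then show False using 0 by simp
        qed
        then have "c (e - Poly_Mapping.single i 1) = 0" by (simp add: c_def shift)
        moreover have "e = 0" using e 0 by simp
        moreover have "c 0 = 1" by (auto simp: c_def intro: exI[of _ 0])
        ultimately show ?thesis by (simp add: one_mfls_def mfls_coeff_monom)
      next
        case (Suc s)
        have "c e = (-1) ^ Suc s" using True e Suc by (simp add: c_def nat_add_distrib)
        moreover have "c (e - Poly_Mapping.single i 1) = (-1) ^ s"
          using Suc by (auto simp: c_def shift)
        moreover have "e \<noteq> 0"
        proof
          assume "e = 0"
          then have "Poly_Mapping.lookup e i = 0" by simp
          then show False using e Suc by simp
        qed
        ultimately show ?thesis by (simp add: one_mfls_def mfls_coeff_monom)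
      qed
    next
      case False
      have "c (e - Poly_Mapping.single i 1) = 0"
      proof (rule ccontr)
        assume "c (e - Poly_Mapping.single i 1) \<noteq> 0"
        then obtain r where "e - Poly_Mapping.single i 1 = Poly_Mapping.single i (int r)"
          by (auto simp: c_def split: if_splits)
        then have "e = Poly_Mapping.single i (int r) + Poly_Mapping.single i 1"
          by (metis diff_add_cancel)
        then have "e = Poly_Mapping.single i (int (Suc r))"
          by (simp add: single_add[symmetric] add.commute)
        then show False using False by blast
      qed
      moreover have "e \<noteq> 0" using False single_zero[of i] by (metis of_nat_0)
      ultimately show ?thesis using False by (simp add: c_def one_mfls_def mfls_coeff_monom)
    qed
    finally show "mfls_coeff ((1 + mfls_var i) * g) e = mfls_coeff 1 e" .
  qed
  then have "inverse (1 + mfls_var i) = g" by (rule mfls_inverse_eqI)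
  then show ?thesis by (simp add: g c_def)
qed

end

theory Submission
  imports Defs "Jordan_Normal_Form.Determinant"
begin

text \<open>
  In the variables \<open>y\<^sub>i = - x\<^sub>i\<close> all signs of the constant term disappear. With
  \<open>z\<^sub>i = y\<^sub>i\<^sup>2 / (1 - y\<^sub>i) = x\<^sub>i\<^sup>2 / (1 + x\<^sub>i)\<close> one has
  \<open>(x\<^sub>i - x\<^sub>j) (x\<^sub>i + x\<^sub>j + x\<^sub>i x\<^sub>j) = (1 + x\<^sub>i) (1 + x\<^sub>j) (z\<^sub>i - z\<^sub>j)\<close>, so the last product is a Vandermonde
  determinant in the \<open>z\<^sub>i\<close>, and the constant term is an \<open>n \<times> n\<close> determinant whose row \<open>i\<close> depends on
  \<open>y\<^sub>i\<close> only; a prescribed bottom entry \<open>b\<^sub>i\<close> contributes the factor \<open>y\<^sub>i\<^bsup>b\<^sub>i + i\<^esup>\<close>.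

  This determinant satisfies the recursion of the generating function for removing the bottom row.
  Subtracting consecutive rows telescopes \<open>y\<^bsup>b\<^sub>i + i\<^esup> - y\<^bsup>b\<^sub>i\<^sub>+\<^sub>1 + i + 1\<^esup>\<close> into \<open>1 - y\<close> times the sum of
  \<open>y\<^bsup>c + i\<^esup>\<close> over \<open>b\<^sub>i \<le> c \<le> b\<^sub>i\<^sub>+\<^sub>1\<close>, and passing from \<open>n\<close> to \<open>n + 1\<close> multiplies the weight by
  \<open>y\<^bsup>- 2\<^esup>\<close>. As \<open>(1 - y) y\<^bsup>- 2\<^esup> = 1 / z\<close>, this only shifts the columns, and the new column or the last row
  is zero except for their common entry, the weight of the bottom right entry of the trapezoid. The recursion also holds
  for \<open>n < k\<close>, so that it can be started at \<open>n = 0\<close>.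
\<close>

section \<open>Laurent series in one variable\<close>

lemma mfls_power_int_diff:
  fixes u :: "'a :: comm_ring_1 mfls"
  assumes "u * inverse u = 1"
  shows "u powi (int r - int s) = u ^ r * inverse u ^ s"
proof (cases "s \<le> r")
  case True
  then obtain t where r: "r = s + t" by (metis le_add_diff_inverse)
  have "u ^ r * inverse u ^ s = u ^ t * (u * inverse u) ^ s"
    by (simp add: r power_add power_mult_distrib)
  then show ?thesis using assms by (simp add: r power_int_def)
next
  \<comment> \<open>For a negative exponent \<open>powi\<close> is a power of
    \<open>inverse u\<close>; the surplus factors \<open>u ^ r\<close> cancel by the
    hypothesis.\<close>
  case False
  then obtain t where s: "s = r + t" by (metis le_add_diff_inverse nle_le)
  have "u ^ r * inverse u ^ s = inverse u ^ t * (u * inverse u) ^ r"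
    by (simp add: s power_add power_mult_distrib)
  then show ?thesis using assms False by (simp add: s power_int_def)
qed

lemma mfls_power_int_add:
  fixes u :: "'a :: comm_ring_1 mfls"
  assumes "u * inverse u = 1"
  shows "u powi (a + b) = u powi a * u powi b"
proof -
  obtain r s where a: "a = int r - int s" by (rule int_diff_cases)
  obtain r' s' where b: "b = int r' - int s'" by (rule int_diff_cases)
  have "a + b = int (r + r') - int (s + s')" using a b by simp
  then have "u powi (a + b) = u ^ (r + r') * inverse u ^ (s + s')"
    using mfls_power_int_diff[OF assms] by presburger
  then show ?thesis
    by (simp add: a b mfls_power_int_diff[OF assms] power_add)
qed

lemma mfls_power_int_sum:
  fixes u :: "'a :: comm_ring_1 mfls"
  assumes "u * inverse u = 1" and "finite A"
  shows "u powi (\<Sum>i\<in>A. f i) = (\<Prod>i\<in>A. u powi f i)"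
  using assms(2) by induction (simp_all add: mfls_power_int_add[OF assms(1)])

lemma mfls_minus_one_unit: "(- 1 :: 'a :: comm_ring_1 mfls) * inverse (- 1) = 1"
  by (simp add: mfls_inverse_minus_one)

lemma mfls_minus_one_powi:
  "(- 1 :: 'a :: comm_ring_1 mfls) powi z = (if even z then 1 else - 1)"
  by (cases "z \<ge> 0") (auto simp: power_int_def mfls_inverse_minus_one uminus_power_if even_nat_iff)

lemma mfls_var_unit: "mfls_var i * inverse (mfls_var i) = (1 :: 'a :: comm_ring_1 mfls)"
proof -
  have "mfls_var i * mfls_monom (Poly_Mapping.single i (- 1)) 1 = (1 :: 'a mfls)"
    by (simp add: mfls_var_def mfls_monom_mult single_add[symmetric] one_mfls_def)
  then show ?thesis using mfls_inverse_eqI by metis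
qed

text \<open>\<open>inverse\<close> is 0 on non-units, so the known constant coefficient 1 of the
  inverse certifies that \<open>1 + mfls_var i\<close> is a unit.\<close>

lemma mfls_one_plus_var_unit:
  "(1 + mfls_var i) * inverse (1 + mfls_var i) = (1 :: 'a :: comm_ring_1 mfls)"
proof -
  have "mfls_coeff (inverse (1 + mfls_var i)) 0 = (1 :: 'a)"
    by (auto simp: mfls_inverse_one_plus_var intro: exI[of _ 0])
  then have "inverse (1 + mfls_var i) \<noteq> (0 :: 'a mfls)"
    by (auto simp: mfls_coeff_zero)
  then have "1 + mfls_var i dvd (1 :: 'a mfls)"
    by (auto simp: inverse_mfls_def split: if_splits)
  then obtain g where "(1 + mfls_var i) * g = (1 :: 'a mfls)" by (metis dvdE)
  then show ?thesis using mfls_inverse_eqI by metis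
qed

section \<open>Supports, and constant terms of products in separate variables\<close>

lemma mfls_coeff_times_nonzeroE:
  fixes f g :: "'a :: comm_ring_1 mfls"
  assumes "mfls_coeff (f * g) e \<noteq> 0"
  obtains a where "mfls_coeff f a \<noteq> 0" "mfls_coeff g (e - a) \<noteq> 0"
  using assms unfolding mfls_coeff_times_supp by (metis (mono_tags, lifting) mem_Collect_eq sum.neutral)

text \<open>These are the series that are power series, not merely Laurent series, in
  \<open>x_i\<close>.\<close>

definition nonneg_in :: "nat \<Rightarrow> 'a :: comm_ring_1 mfls \<Rightarrow> bool" where
  "nonneg_in i f \<longleftrightarrow> (\<forall>e. mfls_coeff f e \<noteq> 0 \<longrightarrow> 0 \<le> Poly_Mapping.lookup e i)"

lemma nonneg_in_one: "nonneg_in i 1"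
  by (simp add: nonneg_in_def one_mfls_def mfls_coeff_monom)

lemma nonneg_in_mult: "nonneg_in i f \<Longrightarrow> nonneg_in i g \<Longrightarrow> nonneg_in i (f * g)"
  unfolding nonneg_in_def
proof clarify
  fix e
  assume f: "\<forall>e. mfls_coeff f e \<noteq> 0 \<longrightarrow> 0 \<le> Poly_Mapping.lookup e i"
    and g: "\<forall>e. mfls_coeff g e \<noteq> 0 \<longrightarrow> 0 \<le> Poly_Mapping.lookup e i"
    and "mfls_coeff (f * g) e \<noteq> 0"
  then obtain a where "mfls_coeff f a \<noteq> 0" "mfls_coeff g (e - a) \<noteq> 0"
    by (meson mfls_coeff_times_nonzeroE)
  then have "0 \<le> Poly_Mapping.lookup a i" "0 \<le> Poly_Mapping.lookup (e - a) i"
    using f g by blast+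
  then show "0 \<le> Poly_Mapping.lookup e i" by (simp add: lookup_minus)
qed

lemma nonneg_in_power: "nonneg_in i f \<Longrightarrow> nonneg_in i (f ^ r)"
  by (induction r) (simp_all add: nonneg_in_one nonneg_in_mult)

lemma nonneg_in_one_plus_var: "nonneg_in i (1 + mfls_var i)"
  by (auto simp: nonneg_in_def mfls_coeff_plus one_mfls_def mfls_var_def mfls_coeff_monom
      lookup_single split: if_splits)

lemma nonneg_in_one_plus_var_powi:
  "nonneg_in i ((1 + mfls_var i) powi z :: 'a :: comm_ring_1 mfls)"
proof -
  have "nonneg_in i (inverse (1 + mfls_var i) :: 'a mfls)"
    by (auto simp: nonneg_in_def mfls_inverse_one_plus_var lookup_single split: if_splits)
  then show ?thesis
    by (auto simp: power_int_def nonneg_in_one_plus_var nonneg_in_power)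
qed

definition vars_in :: "nat set \<Rightarrow> 'a :: comm_ring_1 mfls \<Rightarrow> bool" where
  "vars_in V f \<longleftrightarrow> (\<forall>e. mfls_coeff f e \<noteq> 0 \<longrightarrow> Poly_Mapping.keys e \<subseteq> V)"

lemma vars_in_const: "vars_in V (mfls_const c)"
  by (simp add: vars_in_def mfls_const_def mfls_coeff_monom)

lemma mfls_const_one: "mfls_const 1 = 1"
  by (simp add: mfls_const_def one_mfls_def)

lemma vars_in_one: "vars_in V 1"
  using vars_in_const[of V 1] by (simp add: mfls_const_one)

lemma vars_in_uminus: "vars_in V f \<Longrightarrow> vars_in V (- f)"
  by (simp add: vars_in_def mfls_coeff_uminus)

lemma vars_in_add: "vars_in V f \<Longrightarrow> vars_in V g \<Longrightarrow> vars_in V (f + g)"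
  unfolding vars_in_def mfls_coeff_plus by (metis add.right_neutral)

lemma vars_in_mult:
  assumes f: "vars_in V f" and g: "vars_in W g"
  shows "vars_in (V \<union> W) (f * g)"
  unfolding vars_in_def
proof (intro allI impI)
  fix e
  assume "mfls_coeff (f * g) e \<noteq> 0"
  then obtain a where "mfls_coeff f a \<noteq> 0" "mfls_coeff g (e - a) \<noteq> 0"
    by (rule mfls_coeff_times_nonzeroE)
  then have "Poly_Mapping.keys a \<subseteq> V" "Poly_Mapping.keys (e - a) \<subseteq> W"
    using f g by (auto simp: vars_in_def)
  then show "Poly_Mapping.keys e \<subseteq> V \<union> W"
    using Poly_Mapping.keys_add[of a "e - a"] by auto
qed

lemma vars_in_power: "vars_in V f \<Longrightarrow> vars_in V (f ^ r)"
  by (induction r) (auto simp: vars_in_one dest: vars_in_mult)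

lemma vars_in_prod:
  "(\<And>i. i \<in> A \<Longrightarrow> vars_in (V i) (f i)) \<Longrightarrow> vars_in (\<Union>i\<in>A. V i) (\<Prod>i\<in>A. f i)"
proof (induction A rule: infinite_finite_induct)
  case (insert i A)
  then show ?case using vars_in_mult[of "V i" "f i" "\<Union>i\<in>A. V i" "\<Prod>i\<in>A. f i"] by simp
qed (simp_all add: vars_in_one)

lemma vars_in_var_powi: "vars_in {i} (mfls_var i powi z)"
  by (simp add: vars_in_def mfls_var_powi mfls_coeff_monom)

lemma vars_in_one_plus_var_powi:
  "vars_in {i} ((1 + mfls_var i) powi z :: 'a :: comm_ring_1 mfls)"
proof -
  have "vars_in {i} (mfls_var i :: 'a mfls)"
    using vars_in_var_powi[of i 1] by simp
  then have "vars_in {i} (1 + mfls_var i :: 'a mfls)" by (simp add: vars_in_add vars_in_one)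
  moreover have "vars_in {i} (inverse (1 + mfls_var i) :: 'a mfls)"
    by (auto simp: vars_in_def mfls_inverse_one_plus_var split: if_splits)
  ultimately show ?thesis by (auto simp: power_int_def vars_in_power)
qed

lemma const_term_add: "const_term (f + g) = const_term f + const_term g"
  by (simp add: const_term_def mfls_coeff_plus)

lemma const_term_uminus: "const_term (- f) = - const_term f"
  by (simp add: const_term_def mfls_coeff_uminus)

lemma const_term_diff: "const_term (f - g) = const_term f - const_term (g :: 'a :: comm_ring_1 mfls)"
  by (simp add: const_term_add const_term_uminus diff_conv_add_uminus del: add_uminus_conv_diff)

lemma const_term_zero: "const_term 0 = 0"
  by (simp add: const_term_def mfls_coeff_zero)

lemma const_term_sum: "const_term (\<Sum>i\<in>A. f i) = (\<Sum>i\<in>A. const_term (f i))"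
  by (induction A rule: infinite_finite_induct) (simp_all add: const_term_add const_term_zero)

lemma const_term_const_mult: "const_term (mfls_const c * f) = c * const_term f"
  by (simp add: const_term_def mfls_const_def mfls_coeff_monom_times)

lemma const_term_one: "const_term 1 = 1"
  by (simp add: const_term_def one_mfls_def mfls_coeff_monom)

text \<open>A contributing term pairs an exponent \<open>a\<close> with \<open>- a\<close>. The
  support of \<open>a\<close> then lies in both \<open>V\<close> and \<open>W\<close>, which leaves
  only \<open>a = 0\<close>.\<close>

lemma const_term_mult:
  assumes f: "vars_in V f" and g: "vars_in W g" and VW: "V \<inter> W = {}"
  shows "const_term (f * g) = const_term f * const_term g"
proof -
  have "a = 0" if "mfls_coeff f a \<noteq> 0" "mfls_coeff g (0 - a) \<noteq> 0" for a
  proof -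
    have "Poly_Mapping.keys a \<subseteq> V" "Poly_Mapping.keys (0 - a) \<subseteq> W"
      using that f g unfolding vars_in_def by blast+
    then have "Poly_Mapping.keys a \<subseteq> V" "Poly_Mapping.keys a \<subseteq> W" by auto
    then have "Poly_Mapping.keys a = {}" using VW by blast
    then show "a = 0" by (metis keys_eq_empty)
  qed
  then have "const_term (f * g) = (\<Sum>a\<in>{0}. mfls_coeff f a * mfls_coeff g (0 - a))"
    unfolding const_term_def mfls_coeff_times_supp
    by (intro sum.mono_neutral_left) auto
  then show ?thesis by (simp add: const_term_def)
qed

text \<open>The injection \<open>g\<close> gives each factor its own variable; it will be
  \<open>Suc\<close>, since matrix rows count from 0 and variables from 1.\<close>

lemma const_term_prod:
  assumes "finite A" and "\<And>i. i \<in> A \<Longrightarrow> vars_in {g i} (f i)" and "inj_on g A"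
  shows "const_term (\<Prod>i\<in>A. f i) = (\<Prod>i\<in>A. const_term (f i))"
  using assms
proof (induction A)
  case (insert i A)
  have "vars_in (\<Union>i\<in>A. {g i}) (\<Prod>i\<in>A. f i)"
    by (rule vars_in_prod) (use insert in auto)
  moreover have "{g i} \<inter> (\<Union>i\<in>A. {g i}) = {}"
    using insert by auto
  ultimately have "const_term (f i * (\<Prod>i\<in>A. f i)) = const_term (f i) * const_term (\<Prod>i\<in>A. f i)"
    using const_term_mult insert.prems(1) by blast
  then show ?case using insert by simp
qed (simp add: const_term_one)

text \<open>The series \<open>y\<^sub>i\<^sup>p (1 - y\<^sub>i)\<^sup>q\<close> in the variable \<open>y\<^sub>i = - x\<^sub>i\<close>.\<close>

definition ymon :: "nat \<Rightarrow> int \<Rightarrow> int \<Rightarrow> 'a :: comm_ring_1 mfls" where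
  "ymon i p q = (- 1) powi p * mfls_var i powi p * (1 + mfls_var i) powi q"

lemma ymon_mult: "ymon i p q * ymon i p' q' = ymon i (p + p') (q + q')"
  by (simp add: ymon_def mfls_power_int_add mfls_inverse_minus_one mfls_var_unit
      mfls_one_plus_var_unit mult_ac)

lemma ymon_0_0: "ymon i 0 0 = 1" and ymon_1_0: "ymon i 1 0 = - mfls_var i"
  and ymon_0_1: "ymon i 0 1 = 1 + mfls_var i"
  by (simp_all add: ymon_def)

lemma ymon_power: "ymon i p q ^ r = ymon i (int r * p) (int r * q)"
  by (induction r) (simp_all add: ymon_0_0 ymon_mult algebra_simps)

lemma vars_in_ymon: "vars_in {i} (ymon i p q :: 'a :: comm_ring_1 mfls)"
proof -
  have "vars_in {i} ((- 1) powi p * mfls_var i powi p :: 'a mfls)"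
    by (simp add: mfls_minus_one_powi vars_in_var_powi vars_in_uminus)
  from vars_in_mult[OF this vars_in_one_plus_var_powi[of i q]] show ?thesis
    by (simp add: ymon_def)
qed

text \<open>The coefficient of \<open>y^(-p)\<close> in \<open>(1 - y)^q\<close>, that is,
  \<open>(-1)^p\<close> times the binomial coefficient \<open>q\<close> over
  \<open>-p\<close>.\<close>

definition bincoeff :: "nat \<Rightarrow> int \<Rightarrow> int \<Rightarrow> 'a :: comm_ring_1" where
  "bincoeff i p q = const_term (ymon i p q)"

text \<open>Pascal's rule, from \<open>(1 - y)^(q+1) = (1 - y)^q - y (1 - y)^q\<close>.\<close>

lemma bincoeff_Suc: "bincoeff i p (q + 1) = bincoeff i p q - bincoeff i (p + 1) q"
proof -
  have "ymon i p (q + 1) = ymon i p q * (ymon i 0 0 - ymon i 1 0 :: 'a mfls)"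
    by (simp add: ymon_0_0 ymon_1_0 ymon_0_1[symmetric] ymon_mult)
  also have "\<dots> = ymon i p q - ymon i (p + 1) q"
    by (simp add: right_diff_distrib ymon_mult del: mult_minus_right)
  finally show ?thesis by (simp add: bincoeff_def const_term_diff)
qed

lemma bincoeff_0: "bincoeff i p 0 = (if p = 0 then 1 else 0)"
proof -
  have *: "Poly_Mapping.single i p = 0 \<longleftrightarrow> p = 0"
    by (metis lookup_single_eq lookup_zero single_zero)
  show ?thesis
    by (auto simp: bincoeff_def ymon_def mfls_minus_one_powi mfls_var_powi const_term_def
        mfls_coeff_monom mfls_coeff_uminus * eq_commute[of 0])
qed

lemma bincoeff_pos: "0 < p \<Longrightarrow> bincoeff i p q = 0"
proof -
  assume p: "0 < p"
  have "const_term (mfls_var i powi p * (1 + mfls_var i) powi q) =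
      mfls_coeff ((1 + mfls_var i) powi q :: 'a mfls) (- Poly_Mapping.single i p)"
    by (simp add: const_term_def mfls_var_powi mfls_coeff_monom_times)
  also have "\<dots> = 0"
    using nonneg_in_one_plus_var_powi[of i q, where ?'a = 'a] p
    by (force simp: nonneg_in_def)
  finally show ?thesis
    by (simp add: bincoeff_def ymon_def mfls_minus_one_powi const_term_uminus)
qed

text \<open>Pascal's rule and the boundary values determine everything, and neither depends on the
  variable. All matrix entries can thus be expressed with index 0.\<close>

lemma bincoeff_index: "bincoeff i p q = (bincoeff j p q :: 'a :: comm_ring_1)"
proof (induction q arbitrary: p rule: int_induct[where k = 0])
  case base
  then show ?case by (simp add: bincoeff_0)
next
  case (step1 q)
  then show ?case by (simp add: bincoeff_Suc)
next
  case (step2 q)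
  \<comment> \<open>Downwards in \<open>q\<close>, Pascal's rule refers to \<open>p + 1\<close>; an
    inner descending induction from \<open>p = 1\<close>, where both sides vanish, closes the
    recursion.\<close>
  have rec: "bincoeff i p (q - 1) = bincoeff i p q + (bincoeff i (p + 1) (q - 1) :: 'a)" for i p
    using bincoeff_Suc[of i p "q - 1", where ?'a = 'a] by simp
  show ?case
  proof (cases "0 < p")
    case True
    then show ?thesis by (simp add: bincoeff_pos)
  next
    case False
    then have "p \<le> 1" by simp
    then show ?thesis
    proof (induction p rule: int_le_induct)
      case base
      then show ?case by (simp add: bincoeff_pos)
    next
      case (step p)
      then show ?case using rec[of _ "p - 1"] step2 by simp
    qed
  qed
qed

text \<open>The geometric series \<open>1 / (1 - y)\<close>.\<close>

lemma bincoeff_minus_one: "p \<le> 0 \<Longrightarrow> bincoeff i p (- 1) = (1 :: 'a :: comm_ring_1)"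
proof (induction p rule: int_le_induct)
  case base
  then show ?case
    using bincoeff_Suc[of i 0 "- 1", where ?'a = 'a] by (simp add: bincoeff_0 bincoeff_pos)
next
  case (step p)
  then show ?case
    using bincoeff_Suc[of i "p - 1" "- 1", where ?'a = 'a] by (simp add: bincoeff_0)
qed

text \<open>For \<open>q \<ge> 0\<close> the series \<open>(1 - y)^q\<close> is a polynomial of
  degree at most \<open>q\<close>, and \<open>-p > q\<close>.\<close>

lemma bincoeff_eq_0: "0 \<le> q \<Longrightarrow> p + q < 0 \<Longrightarrow> bincoeff i p q = 0"
proof (induction q arbitrary: p rule: int_ge_induct)
  case base
  then show ?case by (simp add: bincoeff_0)
next
  case (step q)
  then show ?case by (simp add: bincoeff_Suc)
qed

section \<open>Determinants\<close>

lemma det_mat_Leibniz: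
  "det (mat n n (\<lambda>(i, j). f i j)) =
     (\<Sum>p | p permutes {0..<n}. signof p * (\<Prod>i = 0..<n. f i (p i)))"
proof -
  have "(\<Prod>i = 0..<n. mat n n (\<lambda>(i, j). f i j) $$ (i, p i)) = (\<Prod>i = 0..<n. f i (p i))"
    if "p permutes {0..<n}" for p
    by (rule prod.cong[OF refl]) (use permutes_in_image[OF that] in auto)
  then show ?thesis
    by (subst det_def'[of _ n]) (auto intro!: sum.cong)
qed

lemma det_mat_cong:
  assumes "\<And>i j. i < n \<Longrightarrow> j < n \<Longrightarrow> f i j = g i j"
  shows "det (mat n n (\<lambda>(i, j). f i j)) = det (mat n n (\<lambda>(i, j). g i j))"
  by (rule arg_cong[where f = det]) (auto intro!: eq_matI simp: assms)

lemma det_scale_rows: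
  fixes c :: "nat \<Rightarrow> 'a :: comm_ring_1"
  shows "det (mat n n (\<lambda>(i, j). c i * f i j)) =
     (\<Prod>i = 0..<n. c i) * det (mat n n (\<lambda>(i, j). f i j))"
  unfolding det_mat_Leibniz by (simp add: prod.distrib sum_distrib_left mult_ac)

lemma det_last_row:
  fixes f :: "nat \<Rightarrow> nat \<Rightarrow> 'a :: comm_ring_1"
  assumes "\<And>j. j < n \<Longrightarrow> f n j = 0"
  shows "det (mat (Suc n) (Suc n) (\<lambda>(i, j). f i j)) = f n n * det (mat n n (\<lambda>(i, j). f i j))"
proof -
  let ?A = "mat (Suc n) (Suc n) (\<lambda>(i, j). f i j)"
  have "mat_delete ?A n n = mat n n (\<lambda>(i, j). f i j)"
    by (rule eq_matI) (auto simp: mat_delete_def)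
  then show ?thesis
    using assms by (subst laplace_expansion_row[of _ "Suc n" n]) (auto simp: cofactor_def)
qed

lemma det_last_col:
  fixes f :: "nat \<Rightarrow> nat \<Rightarrow> 'a :: comm_ring_1"
  assumes "\<And>i. i < n \<Longrightarrow> f i n = 0"
  shows "det (mat (Suc n) (Suc n) (\<lambda>(i, j). f i j)) = f n n * det (mat n n (\<lambda>(i, j). f i j))"
proof -
  let ?A = "mat (Suc n) (Suc n) (\<lambda>(i, j). f i j)"
  have "mat_delete ?A n n = mat n n (\<lambda>(i, j). f i j)"
    by (rule eq_matI) (auto simp: mat_delete_def)
  then show ?thesis
    using assms by (subst laplace_expansion_column[of _ "Suc n" n]) (auto simp: cofactor_def)
qed

text \<open>Changing all rows at once is left multiplication by the upper bidiagonal matrix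
  \<open>U\<close>, which has unit diagonal.\<close>

lemma det_add_next_row:
  fixes f :: "nat \<Rightarrow> nat \<Rightarrow> 'a :: comm_ring_1"
  shows "det (mat n n (\<lambda>(i, j). f i j + (if Suc i < n then c i * f (Suc i) j else 0))) =
     det (mat n n (\<lambda>(i, j). f i j))"
proof -
  define U :: "'a mat" where
    "U = mat n n (\<lambda>(i, j). if j = i then 1 else if j = Suc i then c i else 0)"
  have U: "U \<in> carrier_mat n n" by (simp add: U_def)
  have "diag_mat U = map (\<lambda>_. 1) [0..<n]"
    by (rule nth_equalityI) (auto simp: diag_mat_def U_def)
  then have det_U: "det U = 1"
    by (subst det_upper_triangular[OF _ U]) (auto simp: U_def map_replicate_const)
  let ?F = "mat n n (\<lambda>(i, j). f i j)"
  have "U * ?F = mat n n (\<lambda>(i, j). f i j + (if Suc i < n then c i * f (Suc i) j else 0))"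
  proof (rule eq_matI)
    fix i j
    assume "i < dim_row (mat n n (\<lambda>(i, j). f i j + (if Suc i < n then c i * f (Suc i) j else 0)))"
      and "j < dim_col (mat n n (\<lambda>(i, j). f i j + (if Suc i < n then c i * f (Suc i) j else 0)))"
    then have ij: "i < n" "j < n" by auto
    have "(U * ?F) $$ (i, j) = (\<Sum>l = 0..<n. (if l = i then 1 else if l = Suc i then c i else 0) * f l j)"
      using ij by (auto simp: U_def scalar_prod_def intro!: sum.cong)
    also have "\<dots> = (\<Sum>l = 0..<n. (if l = i then f i j else 0) + (if l = Suc i then c i * f (Suc i) j else 0))"
      by (rule sum.cong) auto
    also have "\<dots> = f i j + (if Suc i < n then c i * f (Suc i) j else 0)"
      using ij by (simp add: sum.distrib)
    finally show "(U * ?F) $$ (i, j) =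
        mat n n (\<lambda>(i, j). f i j + (if Suc i < n then c i * f (Suc i) j else 0)) $$ (i, j)"
      using ij by simp
  qed (auto simp: U_def)
  then show ?thesis
    using det_mult[OF U, of ?F] det_U by simp
qed

lemma det_add_next_col:
  fixes f :: "nat \<Rightarrow> nat \<Rightarrow> 'a :: comm_ring_1"
  shows "det (mat n n (\<lambda>(i, j). f i j + (if Suc j < n then c j * f i (Suc j) else 0))) =
     det (mat n n (\<lambda>(i, j). f i j))"
proof -
  have transpose: "det (mat n n (\<lambda>(i, j). g i j)) = det (mat n n (\<lambda>(i, j). g j i))"
    for g :: "nat \<Rightarrow> nat \<Rightarrow> 'a"
  proof -
    have "(mat n n (\<lambda>(i, j). g i j))\<^sup>T = mat n n (\<lambda>(i, j). g j i)"
      by (rule eq_matI) auto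
    then show ?thesis using det_transpose[of "mat n n (\<lambda>(i, j). g i j)" n] by simp
  qed
  show ?thesis
    unfolding transpose[of "\<lambda>i j. f i j + (if Suc j < n then c j * f i (Suc j) else 0)"]
      transpose[of f]
    by (rule det_add_next_row)
qed

text \<open>Multilinearity in all rows simultaneously: in the expanded Leibniz formula,
  \<open>c\<close> records which summand each row contributes.\<close>

lemma det_sum_rows:
  fixes u :: "nat \<Rightarrow> 'b \<Rightarrow> 'a :: comm_ring_1"
  assumes fin: "\<And>i. i \<in> {1..n} \<Longrightarrow> finite (X i)"
  shows "det (mat n n (\<lambda>(i, j). \<Sum>t\<in>X (Suc i). u (Suc i) t * f (Suc i) t j)) =
     (\<Sum>c\<in>PiE {1..n} X. (\<Prod>i = 1..n. u i (c i)) *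
        det (mat n n (\<lambda>(i, j). f (Suc i) (c (Suc i)) j)))"
proof -
  have shift: "(\<Prod>i = 0..<n. g (Suc i)) = (\<Prod>i = 1..n. g i)" for g :: "nat \<Rightarrow> 'a"
    using prod.shift_bounds_Suc_ivl[of g 0 n] by (simp add: atLeastLessThanSuc_atLeastAtMost)
  have rows: "(\<Prod>i = 0..<n. \<Sum>t\<in>X (Suc i). u (Suc i) t * f (Suc i) t (p i)) =
      (\<Sum>c\<in>PiE {1..n} X. (\<Prod>i = 1..n. u i (c i)) *
         (\<Prod>i = 0..<n. f (Suc i) (c (Suc i)) (p i)))" for p
  proof -
    have "(\<Prod>i = 0..<n. \<Sum>t\<in>X (Suc i). u (Suc i) t * f (Suc i) t (p i)) =
        (\<Prod>i = 1..n. \<Sum>t\<in>X i. u i t * f i t (p (i - 1)))"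
      using shift[of "\<lambda>i. \<Sum>t\<in>X i. u i t * f i t (p (i - 1))"] by simp
    also have "\<dots> = (\<Sum>c\<in>PiE {1..n} X. \<Prod>i = 1..n. u i (c i) * f i (c i) (p (i - 1)))"
      by (rule prod_sum_PiE) (use fin in auto)
    also have "\<dots> = (\<Sum>c\<in>PiE {1..n} X. (\<Prod>i = 1..n. u i (c i)) *
         (\<Prod>i = 0..<n. f (Suc i) (c (Suc i)) (p i)))"
      using shift[of "\<lambda>i. f i (_ i) (p (i - 1))"] by (simp add: prod.distrib)
    finally show ?thesis .
  qed
  show ?thesis
    unfolding det_mat_Leibniz rows
    by (subst sum_distrib_left, subst sum.swap) (simp add: sum_distrib_left mult_ac)
qed

section \<open>The Vandermonde determinant\<close>

definition pairs :: "nat \<Rightarrow> (nat \<times> nat) set" where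
  "pairs n = {(i, j). 1 \<le> i \<and> i < j \<and> j \<le> n}"

lemma pairs_0: "pairs 0 = {}"
  by (auto simp: pairs_def)

lemma prod_pairs_Suc:
  "(\<Prod>(i, j)\<in>pairs (Suc n). g i j) = (\<Prod>(i, j)\<in>pairs n. g i j) * (\<Prod>i = 1..n. g i (Suc n))"
proof -
  have "finite (pairs n)"
    by (rule finite_subset[of _ "{..n} \<times> {..n}"]) (auto simp: pairs_def)
  moreover have "pairs (Suc n) = pairs n \<union> (\<lambda>i. (i, Suc n)) ` {1..n}"
    by (auto simp: pairs_def le_Suc_eq)
  moreover have "pairs n \<inter> (\<lambda>i. (i, Suc n)) ` {1..n} = {}"
    by (auto simp: pairs_def)
  ultimately show ?thesis
    by (simp add: prod.union_disjoint prod.reindex inj_on_def)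
qed

text \<open>Each index lies in exactly \<open>n - 1\<close> pairs.\<close>

lemma prod_pairs_product:
  fixes u :: "nat \<Rightarrow> 'a :: comm_ring_1"
  shows "(\<Prod>(i, j)\<in>pairs n. u i * u j) = (\<Prod>i = 1..n. u i ^ (n - 1))"
proof (induction n)
  case (Suc n)
  have "(\<Prod>i = 1..n. u i) * (\<Prod>i = 1..n. u i ^ (n - 1)) = (\<Prod>i = 1..n. u i ^ n)"
    unfolding prod.distrib[symmetric]
    by (rule prod.cong) (auto simp: power_Suc[symmetric] simp del: power_Suc)
  then show ?case
    unfolding prod_pairs_Suc Suc by (simp add: prod.distrib mult_ac)
qed (simp_all add: pairs_0)

text \<open>Exponents decrease along a row, so no sign appears. Subtracting \<open>w\<close> times
  the next column clears the last row up to its final 1 and leaves the factor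
  \<open>z (Suc i) - w\<close> in every other row.\<close>

lemma det_Vandermonde:
  fixes z :: "nat \<Rightarrow> 'a :: comm_ring_1"
  shows "det (mat n n (\<lambda>(i, j). z (Suc i) ^ (n - 1 - j))) = (\<Prod>(i, j)\<in>pairs n. z i - z j)"
proof (induction n)
  case (Suc n)
  define w where "w = z (Suc n)"
  let ?f = "\<lambda>i j. z (Suc i) ^ (n - j)"
  let ?g = "\<lambda>i j. ?f i j + (if Suc j < Suc n then - w * ?f i (Suc j) else 0)"
  have g: "?g i j = (z (Suc i) - w) * z (Suc i) ^ (n - 1 - j)" if "j < n" for i j
  proof -
    obtain t where "n = Suc (j + t)" using less_imp_Suc_add[OF \<open>j < n\<close>] by blast
    then show ?thesis by (simp add: algebra_simps)
  qed
  have "det (mat (Suc n) (Suc n) (\<lambda>(i, j). ?f i j)) = det (mat (Suc n) (Suc n) (\<lambda>(i, j). ?g i j))"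
    by (rule det_add_next_col[symmetric])
  also have "\<dots> = ?g n n * det (mat n n (\<lambda>(i, j). ?g i j))"
    by (rule det_last_row) (use g in \<open>simp add: w_def\<close>)
  also have "?g n n = 1" by simp
  also have "det (mat n n (\<lambda>(i, j). ?g i j)) =
      det (mat n n (\<lambda>(i, j). (z (Suc i) - w) * z (Suc i) ^ (n - 1 - j)))"
    by (rule det_mat_cong) (rule g)
  also have "\<dots> = (\<Prod>i = 0..<n. z (Suc i) - w) * (\<Prod>(i, j)\<in>pairs n. z i - z j)"
    by (simp only: det_scale_rows Suc.IH)
  also have "(\<Prod>i = 0..<n. z (Suc i) - w) = (\<Prod>i = 1..n. z i - w)"
    using prod.shift_bounds_Suc_ivl[of "\<lambda>i. z i - w" 0 n]
    by (simp add: atLeastLessThanSuc_atLeastAtMost)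
  finally show ?case by (simp add: prod_pairs_Suc w_def mult_ac)
qed (simp_all add: pairs_0)

section \<open>The constant term as a determinant\<close>

text \<open>
  The constant term of \<open>y\<^sup>p (1 - y)\<^sup>q (P + y / (1 - y)) y\<^bsup>- m - 2n\<^esup> z\<^sup>e\<close>, where \<open>z = y\<^sup>2 / (1 - y)\<close>.
\<close>

definition entry :: "nat \<Rightarrow> 'a :: comm_ring_1 \<Rightarrow> nat \<Rightarrow> int \<Rightarrow> int \<Rightarrow> nat \<Rightarrow> 'a" where
  "entry m P n p q e =
     P * bincoeff 0 (p - int m - 2 * int n + 2 * int e) (q - int e) +
     bincoeff 0 (p + 1 - int m - 2 * int n + 2 * int e) (q - int e - 1)"

text \<open>For \<open>i \<le> n - k\<close> the two summands come from the extra factor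
  \<open>Q + y / (1 - y)\<close>, attached to \<open>y^(i+1) (1 - y)^(n-k-i+1)\<close>.\<close>

definition magog_row :: "nat \<Rightarrow> 'a :: comm_ring_1 \<Rightarrow> 'a \<Rightarrow> nat \<Rightarrow> nat \<Rightarrow> nat \<Rightarrow> nat \<Rightarrow> nat \<Rightarrow> 'a" where
  "magog_row m P Q n k i t e =
     (if i \<le> n - k then
        Q * entry m P n (int i + 1) (int n - int k - int i + 1) e +
        entry m P n (int i + 2) (int n - int k - int i) e
      else entry m P n (int t + int i) 0 e)"

definition magog_det ::
    "nat \<Rightarrow> 'a :: comm_ring_1 \<Rightarrow> 'a \<Rightarrow> nat \<Rightarrow> nat \<Rightarrow> (nat \<Rightarrow> nat) \<Rightarrow> 'a" where
  "magog_det m P Q n k b =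
     det (mat n n (\<lambda>(i, j). magog_row m P Q n k (Suc i) (b (Suc i)) (n - 1 - j)))"

lemma const_term_signof_mult: "const_term (signof p * f) = signof p * const_term f"
  by (simp add: sign_def const_term_uminus)

text \<open>Row scaling absorbs \<open>\<Phi> i\<close> into the Vandermonde matrix. Each Leibniz
  term then has one factor per variable, so its constant term splits.\<close>

lemma const_term_prod_det:
  fixes \<Phi> z :: "nat \<Rightarrow> 'a :: comm_ring_1 mfls"
  assumes \<Phi>: "\<And>i. i \<in> {1..n} \<Longrightarrow> vars_in {i} (\<Phi> i)" and z: "\<And>i. i \<in> {1..n} \<Longrightarrow> vars_in {i} (z i)"
  shows "const_term ((\<Prod>i = 1..n. \<Phi> i) * (\<Prod>(i, j)\<in>pairs n. z i - z j)) =
    det (mat n n (\<lambda>(i, j). const_term (\<Phi> (Suc i) * z (Suc i) ^ (n - 1 - j))))"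
proof -
  have "(\<Prod>i = 1..n. \<Phi> i) = (\<Prod>i = 0..<n. \<Phi> (Suc i))"
    using prod.shift_bounds_Suc_ivl[of \<Phi> 0 n] by (simp add: atLeastLessThanSuc_atLeastAtMost)
  then have "(\<Prod>i = 1..n. \<Phi> i) * (\<Prod>(i, j)\<in>pairs n. z i - z j) =
      det (mat n n (\<lambda>(i, j). \<Phi> (Suc i) * z (Suc i) ^ (n - 1 - j)))"
    by (simp add: det_Vandermonde[symmetric] det_scale_rows)
  also have "const_term \<dots> = (\<Sum>p | p permutes {0..<n}. signof p *
      const_term (\<Prod>i = 0..<n. \<Phi> (Suc i) * z (Suc i) ^ (n - 1 - p i)))"
    unfolding det_mat_Leibniz const_term_sum const_term_signof_mult ..
  also have "\<dots> = (\<Sum>p | p permutes {0..<n}. signof p *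
      (\<Prod>i = 0..<n. const_term (\<Phi> (Suc i) * z (Suc i) ^ (n - 1 - p i))))"
  proof (intro sum.cong refl arg_cong2[where f = "(*)"] const_term_prod)
    fix p i
    assume "i \<in> {0..<n}"
    then have "vars_in {Suc i} (\<Phi> (Suc i))" "vars_in {Suc i} (z (Suc i))"
      by (auto intro!: \<Phi> z)
    then show "vars_in {Suc i} (\<Phi> (Suc i) * z (Suc i) ^ (n - 1 - p i))"
      using vars_in_mult vars_in_power by fastforce
  qed auto
  finally show ?thesis by (simp only: det_mat_Leibniz)
qed

section \<open>Change of variables from \<open>x\<close> to \<open>y\<close>\<close>

lemma x_eq_ymon: "mfls_var i = - ymon i 1 0"
  by (simp add: ymon_1_0)

lemma one_plus_x_powi_eq_ymon: "(1 + mfls_var i) powi q = ymon i 0 q"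
  by (simp add: ymon_def)

lemma x_powi_eq_ymon: "mfls_var i powi p = (- 1) powi p * ymon i p 0"
  by (simp add: ymon_def mfls_minus_one_powi)

lemma pair_factor_eq:
  "(mfls_var i - mfls_var j) * (mfls_var i + mfls_var j + mfls_var i * mfls_var j) =
     ((1 + mfls_var i) * (1 + mfls_var j)) * (ymon i 2 (- 1) - ymon j 2 (- 1) :: 'a :: comm_ring_1 mfls)"
proof -
  have z: "(1 + mfls_var l) * ymon l 2 (- 1) = (mfls_var l * mfls_var l :: 'a mfls)" for l
  proof -
    have "(1 + mfls_var l) * ymon l 2 (- 1) = (ymon l 1 0 * ymon l 1 0 :: 'a mfls)"
      by (simp add: ymon_0_1[symmetric] ymon_mult)
    then show ?thesis by (simp add: ymon_1_0)
  qed
  have "((1 + mfls_var i) * (1 + mfls_var j)) * (ymon i 2 (- 1) - ymon j 2 (- 1)) =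
      (1 + mfls_var j) * ((1 + mfls_var i) * ymon i 2 (- 1)) -
      (1 + mfls_var i) * ((1 + mfls_var j) * (ymon j 2 (- 1) :: 'a mfls))"
    by (simp add: algebra_simps)
  then show ?thesis unfolding z by (simp add: algebra_simps)
qed

lemma ymon_mult_left: "ymon i p q * (ymon i p' q' * f) = ymon i (p + p') (q + q') * f"
  by (simp add: mult.assoc[symmetric] ymon_mult)

text \<open>The series whose constant term against \<open>z^e\<close> is \<open>entry\<close>. Its
  factor \<open>P + y / (1 - y)\<close> stems from
  \<open>x - P (1 + x) = - (1 - y) (P + y / (1 - y))\<close>.\<close>

definition free_factor :: "nat \<Rightarrow> 'a :: comm_ring_1 \<Rightarrow> nat \<Rightarrow> int \<Rightarrow> int \<Rightarrow> nat \<Rightarrow> 'a mfls" where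
  "free_factor m P n p q i =
     mfls_const P * ymon i (p - int m - 2 * int n) q +
     ymon i (p + 1 - int m - 2 * int n) (q - 1)"

lemma vars_in_free_factor: "vars_in {i} (free_factor m P n p q i)"
proof -
  have "vars_in ({i} \<union> {i}) (mfls_const P * ymon i (p - int m - 2 * int n) q)"
    by (intro vars_in_mult vars_in_const vars_in_ymon)
  then show ?thesis
    by (simp add: free_factor_def vars_in_add vars_in_ymon)
qed

lemma const_term_free_factor:
  "const_term (free_factor m P n p q i * ymon i 2 (- 1) ^ e) = entry m P n p q e"
proof -
  have "free_factor m P n p q i * ymon i 2 (- 1) ^ e =
      mfls_const P * ymon i (p - int m - 2 * int n + 2 * int e) (q - int e) +
      ymon i (p + 1 - int m - 2 * int n + 2 * int e) (q - int e - 1)"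
    by (simp add: free_factor_def ymon_power distrib_right mult.assoc ymon_mult algebra_simps)
  then show ?thesis
    by (simp add: entry_def const_term_add const_term_const_mult bincoeff_def[symmetric]
        bincoeff_index[of i _ _ 0])
qed

definition row_factor ::
    "nat \<Rightarrow> 'a :: comm_ring_1 \<Rightarrow> 'a \<Rightarrow> nat \<Rightarrow> nat \<Rightarrow> nat \<Rightarrow> nat \<Rightarrow> 'a mfls" where
  "row_factor m P Q n k i t =
     (if i \<le> n - k then
        mfls_const Q * free_factor m P n (int i + 1) (int n - int k - int i + 1) i +
        free_factor m P n (int i + 2) (int n - int k - int i) i
      else free_factor m P n (int t + int i) 0 i)"

lemma vars_in_row_factor: "vars_in {i} (row_factor m P Q n k i t)"
proof -
  have "vars_in ({i} \<union> {i}) (mfls_const Q * free_factor m P n p q i)" for p q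
    by (intro vars_in_mult vars_in_const vars_in_free_factor)
  then show ?thesis
    by (simp add: row_factor_def vars_in_add vars_in_free_factor)
qed

lemma const_term_row_factor:
  "const_term (row_factor m P Q n k i t * ymon i 2 (- 1) ^ e) = magog_row m P Q n k i t e"
  by (simp add: row_factor_def magog_row_def distrib_right mult.assoc const_term_add
      const_term_const_mult const_term_free_factor)

lemma mfls_minus_one_powi_add:
  "(- 1 :: 'a :: comm_ring_1 mfls) powi (a + b) = (- 1) powi a * (- 1) powi b"
  by (rule mfls_power_int_add) (simp add: mfls_inverse_minus_one)

text \<open>The \<open>n - 1\<close> factors \<open>1 + x_i\<close> come from the pairs containing
  \<open>i\<close>; with the one extracted from \<open>x_i - P (1 + x_i)\<close> they cancel the
  power \<open>- n\<close>.\<close>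

lemma row_factor_bottom:
  assumes "n - k < i" and "1 \<le> n"
  shows "row_factor m P Q n k i t =
    (- 1) powi (int m - 1 + int i + int t) *
    ((1 + mfls_var i) powi (- int n) *
     mfls_var i powi (- int m - 2 * int n + int t + int i) *
     (mfls_var i - mfls_const P * (1 + mfls_var i))) * (1 + mfls_var i) ^ (n - 1)"
proof -
  let ?p = "- int m - 2 * int n + int t + int i"
  \<comment> \<open>The value -1 offsets the sign change of \<open>x - P (1 + x)\<close> in terms of
    \<open>y\<close>.\<close>
  have s: "(- 1) powi (int m - 1 + int i + int t) * (- 1) powi ?p = (- 1 :: 'a mfls)"
  proof -
    have "int m - 1 + int i + int t + ?p = 2 * (int i + int t - int n) - 1" by simp
    then show ?thesis unfolding mfls_minus_one_powi_add[symmetric] by (simp add: mfls_minus_one_powi)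
  qed
  have "(- 1) powi (int m - 1 + int i + int t) *
    ((1 + mfls_var i) powi (- int n) * mfls_var i powi ?p *
     (mfls_var i - mfls_const P * (1 + mfls_var i))) * (1 + mfls_var i) ^ (n - 1) =
    ((- 1) powi (int m - 1 + int i + int t) * (- 1) powi ?p) *
    (ymon i 0 (- int n) * (ymon i ?p 0 * (- ymon i 1 0 - mfls_const P * ymon i 0 1))) *
     ymon i 0 1 ^ (n - 1)"
    unfolding one_plus_x_powi_eq_ymon x_powi_eq_ymon
    unfolding ymon_0_1[symmetric] unfolding x_eq_ymon
    by (simp only: mult_ac)
  also have "\<dots> = (ymon i 1 0 + mfls_const P * ymon i 0 1) * ymon i ?p (- 1)"
    unfolding s ymon_power using assms(2)
    by (simp add: ymon_mult ymon_mult_left algebra_simps of_nat_diff)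
  also have "\<dots> = free_factor m P n (int t + int i) 0 i"
    by (simp add: free_factor_def distrib_right mult.assoc ymon_mult algebra_simps)
  finally show ?thesis using assms by (simp add: row_factor_def)
qed

lemma row_factor_free:
  assumes "i \<le> n - k" and "1 \<le> i"
  shows "row_factor m P Q n k i t =
    (- 1) powi (int m - 1 + int i) *
    ((1 + mfls_var i) powi (- int i - int k) *
     mfls_var i powi (- int m - 2 * int n + int i + 1) *
     (mfls_var i - mfls_const P * (1 + mfls_var i)) *
     (mfls_var i - mfls_const Q * (1 + mfls_var i))) * (1 + mfls_var i) ^ (n - 1)"
proof -
  let ?p = "- int m - 2 * int n + int i + 1"
  \<comment> \<open>The factors with \<open>P\<close> and \<open>Q\<close> both change sign in terms
    of \<open>y\<close>, so here the value must be 1.\<close>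
  have s: "(- 1) powi (int m - 1 + int i) * (- 1) powi ?p = (1 :: 'a mfls)"
  proof -
    have "int m - 1 + int i + ?p = 2 * (int i - int n)" by simp
    then show ?thesis unfolding mfls_minus_one_powi_add[symmetric] by (simp add: mfls_minus_one_powi)
  qed
  have n: "int (n - 1) = int n - 1" using assms by simp
  let ?Y = "- ymon i 1 0 - mfls_const P * ymon i 0 1"
  let ?Z = "- ymon i 1 0 - mfls_const Q * ymon i 0 1"
  have "(- 1) powi (int m - 1 + int i) *
    ((1 + mfls_var i) powi (- int i - int k) * mfls_var i powi ?p *
     (mfls_var i - mfls_const P * (1 + mfls_var i)) *
     (mfls_var i - mfls_const Q * (1 + mfls_var i))) * (1 + mfls_var i) ^ (n - 1) =
    ((- 1) powi (int m - 1 + int i) * (- 1) powi ?p) *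
    (?Y * (?Z * (ymon i 0 (- int i - int k) * (ymon i ?p 0 * ymon i 0 1 ^ (n - 1)))))"
    unfolding one_plus_x_powi_eq_ymon x_powi_eq_ymon
    unfolding ymon_0_1[symmetric] unfolding x_eq_ymon
    by (simp only: mult_ac)
  also have "\<dots> = (ymon i 1 0 + mfls_const P * ymon i 0 1) *
      ((ymon i 1 0 + mfls_const Q * ymon i 0 1) * ymon i ?p (int n - 1 - int i - int k))"
    unfolding s ymon_power n
    by (simp add: ymon_mult ymon_mult_left algebra_simps)
  also have "\<dots> = mfls_const Q * free_factor m P n (int i + 1) (int n - int k - int i + 1) i +
        free_factor m P n (int i + 2) (int n - int k - int i) i"
    by (simp add: free_factor_def ymon_mult ymon_mult_left algebra_simps)
  finally show ?thesis using assms by (simp add: row_factor_def)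
qed

lemma const_term_eq_magog_det:
  fixes m n k :: nat and b :: "nat \<Rightarrow> nat" and P Q :: "'a :: comm_ring_1"
    and x :: "nat \<Rightarrow> 'a mfls"
  defines "x \<equiv> mfls_var"
  assumes "1 \<le> k" and "k \<le> n"
  shows "const_term
          ((-1) powi ((int m - 1) * int n + int ((n + 1) choose 2) + (\<Sum>i = n - k + 1..n. int (b i))) *
           (\<Prod>i = 1..n - k.
              (1 + x i) powi (- int i - int k) *
              x i powi (- int m - 2 * int n + int i + 1) *
              (x i - mfls_const P * (1 + x i)) *
              (x i - mfls_const Q * (1 + x i))) *
           (\<Prod>i = n - k + 1..n.
              (1 + x i) powi (- int n) *
              x i powi (- int m - 2 * int n + int (b i) + int i) *
              (x i - mfls_const P * (1 + x i))) *
           (\<Prod>(i, j) \<in> {(i, j). 1 \<le> i \<and> i < j \<and> j \<le> n}.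
              (x i - x j) * (x i + x j + x i * x j))) =
     magog_det m P Q n k b"
proof -
  define A where "A i = (1 + x i) powi (- int i - int k) *
              x i powi (- int m - 2 * int n + int i + 1) *
              (x i - mfls_const P * (1 + x i)) *
              (x i - mfls_const Q * (1 + x i))" for i
  define B where "B i = (1 + x i) powi (- int n) *
              x i powi (- int m - 2 * int n + int (b i) + int i) *
              (x i - mfls_const P * (1 + x i))" for i
  define z where "z i = (ymon i 2 (- 1) :: 'a mfls)" for i
  \<comment> \<open>The sign is distributed over the positions: \<open>i\<close> receives the
    exponent \<open>s i\<close>, and in addition \<open>b i\<close> if its entry is
    prescribed.\<close>
  define s where "s i = int m - 1 + int i" for i :: nat
  have split: "{1..n} = {1..n - k} \<union> {n - k + 1..n}" "{1..n - k} \<inter> {n - k + 1..n} = {}"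
    by auto
  have prod_split: "(\<Prod>i = 1..n. g i) = (\<Prod>i = 1..n - k. g i) * (\<Prod>i = n - k + 1..n. g i)"
    for g :: "nat \<Rightarrow> 'a mfls"
    unfolding split(1) by (rule prod.union_disjoint) (use split(2) in auto)
  have "(\<Sum>i = 1..n. s i) = (int m - 1) * int n + int ((n + 1) choose 2)"
    unfolding s_def by (induction n) (auto simp: algebra_simps numeral_2_eq_2)
  then have exponent: "(int m - 1) * int n + int ((n + 1) choose 2) + (\<Sum>i = n - k + 1..n. int (b i)) =
      (\<Sum>i = 1..n. s i) + (\<Sum>i = n - k + 1..n. int (b i))" by simp
  have unit: "(- 1 :: 'a mfls) * inverse (- 1) = 1" by (rule mfls_minus_one_unit)
  have sign: "(- 1) powi ((\<Sum>i = 1..n. s i) + (\<Sum>i = n - k + 1..n. int (b i))) =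
      (\<Prod>i = 1..n - k. (- 1) powi s i) *
      (\<Prod>i = n - k + 1..n. (- 1 :: 'a mfls) powi (s i + int (b i)))"
    unfolding mfls_minus_one_powi_add mfls_power_int_sum[OF unit finite_atLeastAtMost]
      prod_split prod.distrib by (simp only: mult_ac)
  have pairs: "(\<Prod>(i, j) \<in> {(i, j). 1 \<le> i \<and> i < j \<and> j \<le> n}.
              (x i - x j) * (x i + x j + x i * x j)) =
      (\<Prod>i = 1..n. (1 + x i) ^ (n - 1)) * (\<Prod>(i, j) \<in> pairs n. z i - z j)"
    unfolding prod_pairs_product[symmetric] prod.distrib[symmetric] pairs_def[symmetric]
    by (rule prod.cong) (auto simp: x_def z_def pair_factor_eq)
  have "(\<Prod>i = 1..n. row_factor m P Q n k i (b i)) =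
      (\<Prod>i = 1..n - k. (- 1) powi s i * A i * (1 + x i) ^ (n - 1)) *
      (\<Prod>i = n - k + 1..n. (- 1) powi (s i + int (b i)) * B i * (1 + x i) ^ (n - 1))"
    unfolding prod_split
    by (intro arg_cong2[where f = "(*)"] prod.cong refl)
       (use assms(2,3) in \<open>auto simp: row_factor_free row_factor_bottom s_def A_def B_def x_def\<close>)
  then have "(- 1) powi ((int m - 1) * int n + int ((n + 1) choose 2) + (\<Sum>i = n - k + 1..n. int (b i))) *
      (\<Prod>i = 1..n - k. A i) * (\<Prod>i = n - k + 1..n. B i) *
      (\<Prod>(i, j) \<in> {(i, j). 1 \<le> i \<and> i < j \<and> j \<le> n}. (x i - x j) * (x i + x j + x i * x j)) =
      (\<Prod>i = 1..n. row_factor m P Q n k i (b i)) * (\<Prod>(i, j) \<in> pairs n. z i - z j)"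
    unfolding exponent sign pairs prod_split[of "\<lambda>i. (1 + x i) ^ (n - 1)"]
    by (simp only: prod.distrib mult_ac)
  moreover have "const_term ((\<Prod>i = 1..n. row_factor m P Q n k i (b i)) *
      (\<Prod>(i, j) \<in> pairs n. z i - z j)) = magog_det m P Q n k b"
    unfolding magog_det_def
    by (subst const_term_prod_det)
       (simp_all add: z_def vars_in_row_factor vars_in_ymon const_term_row_factor)
  ultimately show ?thesis unfolding A_def B_def by simp
qed

section \<open>Adding a row: the determinant\<close>

text \<open>Multiplication by \<open>1 - y\<close>: Pascal's rule in both terms.\<close>

lemma entry_add_one: "entry m P n p (q + 1) e = entry m P n p q e - entry m P n (p + 1) q e"
proof -
  define a where "a = p - int m - 2 * int n + 2 * int e"
  have "entry m P n p (q + 1) e =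
      P * bincoeff 0 a ((q - int e) + 1) + bincoeff 0 (a + 1) ((q - int e - 1) + 1)"
    "entry m P n p q e = P * bincoeff 0 a (q - int e) + bincoeff 0 (a + 1) (q - int e - 1)"
    "entry m P n (p + 1) q e =
      P * bincoeff 0 (a + 1) (q - int e) + bincoeff 0 (a + 1 + 1) (q - int e - 1)"
    by (simp_all add: entry_def a_def algebra_simps)
  then show ?thesis by (simp only: bincoeff_Suc) (simp add: algebra_simps)
qed

text \<open>The three increments contribute \<open>y^(-2)\<close>, \<open>1 - y\<close> and
  \<open>z\<close>, whose product is 1.\<close>

lemma entry_Suc: "entry m P (Suc n) p (q + 1) (Suc e) = entry m P n p q e"
  by (simp add: entry_def algebra_simps)

text \<open>Without a power of \<open>z\<close>, the coefficient of \<open>y^(m+2n+2-p)\<close> in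
  \<open>(1 - y)^q\<close> exceeds the degree, likewise with both exponents lowered by one;
  \<open>1 \<le> q\<close> keeps the second power polynomial.\<close>

lemma entry_Suc_0:
  "1 \<le> q \<Longrightarrow> p + q \<le> int m + 2 * int n + 1 \<Longrightarrow> entry m P (Suc n) p q 0 = 0"
  by (simp add: entry_def bincoeff_eq_0)

lemma sum_entry:
  assumes "a \<le> Suc c"
  shows "(\<Sum>t = a..c. entry m P n (int t + int i) 1 e) =
    entry m P n (int a + int i) 0 e - entry m P n (int (Suc c) + int i) 0 e"
proof -
  have "entry m P n (int t + int i) 1 e =
      - entry m P n (int (Suc t) + int i) 0 e - - entry m P n (int t + int i) 0 e" for t
    using entry_add_one[of m P n "int t + int i" 0 e] by (simp add: add_ac)
  then have "(\<Sum>t = a..c. entry m P n (int t + int i) 1 e) =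
      (\<Sum>t = a..c. - entry m P n (int (Suc t) + int i) 0 e - - entry m P n (int t + int i) 0 e)"
    by presburger
  also have "\<dots> = - entry m P n (int (Suc c) + int i) 0 e - - entry m P n (int a + int i) 0 e"
    by (rule sum_Suc_diff[OF assms])
  finally show ?thesis by simp
qed

text \<open>
  The case \<open>i \<le> n - k\<close> concerns positions outside the trapezoid, where arrays are \<open>0\<close>; with it, row
  \<open>n\<close> is a function on all of \<open>{1..n}\<close>, matching the rows of the determinant.
\<close>

definition step_range :: "nat \<Rightarrow> nat \<Rightarrow> (nat \<Rightarrow> nat) \<Rightarrow> nat \<Rightarrow> nat set" where
  "step_range n k b i =
     (if i \<le> n - k then {0}
      else if i = Suc n - k then {1..b (Suc i)}
      else {b i..b (Suc i)})"

text \<open>Once a row is added below, the left end of row \<open>n\<close> counts as a possible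
  minimum. For \<open>n < k\<close> the index \<open>Suc n - k\<close> is 0 and no position of
  \<open>{1..n}\<close> is affected.\<close>

definition step_weight :: "'a :: comm_ring_1 \<Rightarrow> nat \<Rightarrow> nat \<Rightarrow> nat \<Rightarrow> nat \<Rightarrow> 'a" where
  "step_weight Q n k i t = (if i = Suc n - k \<and> t = 1 then Q else 1)"

text \<open>The value of row \<open>i\<close> after subtraction of the next one. All exponents of
  \<open>1 - y\<close> exceed those of \<open>magog_row\<close> for \<open>n\<close> by one, as
  \<open>entry_Suc\<close> requires.\<close>

definition step_row ::
    "nat \<Rightarrow> 'a :: comm_ring_1 \<Rightarrow> 'a \<Rightarrow> nat \<Rightarrow> nat \<Rightarrow> (nat \<Rightarrow> nat) \<Rightarrow> nat \<Rightarrow> nat \<Rightarrow> 'a" where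
  "step_row m P Q n k b i e =
     (if i \<le> n - k then
        Q * entry m P (Suc n) (int i + 1) (int n - int k - int i + 1 + 1) e +
        entry m P (Suc n) (int i + 2) (int n - int k - int i + 1) e
      else \<Sum>t\<in>step_range n k b i. step_weight Q n k i t * entry m P (Suc n) (int t + int i) 1 e)"

section \<open>Row subtraction and the shift of columns\<close>

lemma finite_step_range: "finite (step_range n k b i)"
  by (simp add: step_range_def)

text \<open>The delicate case is the last free row, \<open>i = Suc n - k\<close>:
  \<open>Q (1 - y) y^(i+1) + y^(i+2)\<close> minus the first prescribed row is \<open>1 - y\<close>
  times a sum over \<open>1..b (Suc i)\<close> in which exactly the term \<open>t = 1\<close>
  carries \<open>Q\<close>.\<close>

lemma row_diff:
  assumes k: "1 \<le> k" and i: "1 \<le> i" "i \<le> n"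
    and pos: "\<forall>i \<in> {Suc n - k + 1..Suc n}. 0 < b i"
    and mono: "\<forall>i \<in> {Suc n - k + 1..<Suc n}. b i \<le> b (Suc i)"
  shows "magog_row m P Q (Suc n) k i (b i) e -
      (if Suc n - k \<le> i then magog_row m P Q (Suc n) k (Suc i) (b (Suc i)) e else 0) =
    step_row m P Q n k b i e"
proof -
  consider "i \<le> n - k" | "i = Suc n - k" | "Suc n - k < i" by linarith
  then show ?thesis
  proof cases
    case 1
    then have "i < Suc n - k" using i by linarith
    then show ?thesis using 1 by (simp add: magog_row_def step_row_def algebra_simps)
  next
    case 2
    then have kn: "k \<le> n" using i by linarith
    have ik: "int i = int n + 1 - int k" using 2 kn by simp
    have b: "1 \<le> b (Suc i)" using bspec[OF pos, of "Suc i"] 2 i by simp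
    have "step_row m P Q n k b i e =
        (\<Sum>t = 1..b (Suc i). step_weight Q n k i t * entry m P (Suc n) (int t + int i) 1 e)"
      using 2 kn by (auto simp: step_row_def step_range_def)
    also have "\<dots> = Q * entry m P (Suc n) (1 + int i) 1 e +
        (\<Sum>t = 2..b (Suc i). step_weight Q n k i t * entry m P (Suc n) (int t + int i) 1 e)"
      using b 2 by (simp add: sum.atLeast_Suc_atMost numeral_2_eq_2 step_weight_def)
    also have "(\<Sum>t = 2..b (Suc i). step_weight Q n k i t * entry m P (Suc n) (int t + int i) 1 e) =
        (\<Sum>t = 2..b (Suc i). entry m P (Suc n) (int t + int i) 1 e)"
      by (rule sum.cong) (auto simp: step_weight_def)
    also have "\<dots> = entry m P (Suc n) (2 + int i) 0 e -
        entry m P (Suc n) (int (Suc (b (Suc i))) + int i) 0 e"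
      using sum_entry[of 2 "b (Suc i)"] b by simp
    finally have "step_row m P Q n k b i e = Q * entry m P (Suc n) (1 + int i) 1 e +
        (entry m P (Suc n) (2 + int i) 0 e - entry m P (Suc n) (int (Suc (b (Suc i))) + int i) 0 e)" .
    moreover have "magog_row m P Q (Suc n) k i (b i) e =
        Q * entry m P (Suc n) (1 + int i) 1 e + entry m P (Suc n) (2 + int i) 0 e"
    proof -
      have "int (Suc n) - int k - int i = 0" "i \<le> Suc n - k" using 2 ik by simp_all
      then show ?thesis by (simp only: magog_row_def if_True) (simp add: add_ac)
    qed
    moreover have "magog_row m P Q (Suc n) k (Suc i) (b (Suc i)) e =
        entry m P (Suc n) (int (Suc (b (Suc i))) + int i) 0 e"
    proof -
      have "\<not> Suc i \<le> Suc n - k" using 2 by simp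
      then show ?thesis by (simp only: magog_row_def if_False) (simp add: add_ac)
    qed
    ultimately show ?thesis using 2 by simp
  next
    case 3
    have "b i \<le> b (Suc i)" using mono 3 i by auto
    then have "(\<Sum>t = b i..b (Suc i). entry m P (Suc n) (int t + int i) 1 e) =
        entry m P (Suc n) (int (b i) + int i) 0 e -
        entry m P (Suc n) (int (Suc (b (Suc i))) + int i) 0 e"
      by (intro sum_entry) simp
    moreover have "step_row m P Q n k b i e =
        (\<Sum>t = b i..b (Suc i). entry m P (Suc n) (int t + int i) 1 e)"
      using 3 by (auto simp: step_row_def step_range_def step_weight_def)
    ultimately show ?thesis using 3 by (simp add: magog_row_def add_ac)
  qed
qed

lemma step_row_Suc:
  assumes "1 \<le> i"
  shows "step_row m P Q n k b i (Suc e) =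
    (\<Sum>t\<in>step_range n k b i. step_weight Q n k i t * magog_row m P Q n k i t e)"
proof (cases "i \<le> n - k")
  case True
  then show ?thesis
    unfolding step_row_def entry_Suc by (simp add: step_range_def step_weight_def magog_row_def entry_Suc)
next
  case False
  have "entry m P (Suc n) p 1 (Suc e) = entry m P n p 0 e" for p
    using entry_Suc[of m P n p 0 e] by simp
  then show ?thesis using False by (simp add: step_row_def magog_row_def)
qed

text \<open>The bound on \<open>b\<close> keeps all exponents within the degree condition of
  \<open>entry_Suc_0\<close>, so the last column vanishes above its corner.\<close>

lemma step_row_0:
  assumes k: "1 \<le> k" and i: "1 \<le> i" "i \<le> n"
    and b: "\<And>j. Suc n - k < j \<Longrightarrow> j \<le> Suc n \<Longrightarrow> b j \<le> m + n"
  shows "step_row m P Q n k b i 0 = 0"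
proof (cases "i \<le> n - k")
  case True
  then have "int i + 1 + (int n - int k - int i + 1 + 1) \<le> int m + 2 * int n + 1"
    using k i by linarith
  then show ?thesis
    using True i by (simp add: step_row_def entry_Suc_0)
next
  case False
  have "entry m P (Suc n) (int t + int i) 1 0 = 0" if t: "t \<in> step_range n k b i" for t
  proof -
    have "t \<le> b (Suc i)" using t False by (auto simp: step_range_def split: if_splits)
    also have "b (Suc i) \<le> m + n" using False i k by (intro b) auto
    finally show ?thesis using i by (intro entry_Suc_0) auto
  qed
  then show ?thesis using False by (simp add: step_row_def)
qed

section \<open>The corner entry and the recursion of the determinant\<close>

definition max_weight :: "nat \<Rightarrow> 'a :: comm_ring_1 \<Rightarrow> nat \<Rightarrow> nat \<Rightarrow> 'a" where
  "max_weight m P n t = (if t < m + n then 1 else if t = m + n then P else 0)"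

text \<open>The geometric series contributes 1 for \<open>t < m + n\<close>, and \<open>P\<close>
  appears only at \<open>t = m + n\<close>. The value 0 beyond that matches the absence of
  trapezoids with so large an entry.\<close>

lemma entry_last_0:
  "entry m P n (int t + int n) 0 0 = max_weight m P n t"
proof -
  consider "t < m + n" | "t = m + n" | "m + n < t" by linarith
  then show ?thesis
    by cases (simp_all add: entry_def max_weight_def bincoeff_0 bincoeff_pos bincoeff_minus_one)
qed

lemma entry_last_pos:
  "m + n \<le> t \<Longrightarrow> 0 < e \<Longrightarrow> entry m P n (int t + int n) 0 e = 0"
  by (simp add: entry_def bincoeff_pos)

lemma magog_det_Suc:
  assumes k: "1 \<le> k"
    and pos: "\<forall>i \<in> {Suc n - k + 1..Suc n}. 0 < b i"
    and mono: "\<forall>i \<in> {Suc n - k + 1..<Suc n}. b i \<le> b (Suc i)"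
  shows "magog_det m P Q (Suc n) k b = max_weight m P (Suc n) (b (Suc n)) *
    (\<Sum>c\<in>PiE {1..n} (step_range n k b).
       (\<Prod>i = 1..n. step_weight Q n k i (c i)) * magog_det m P Q n k c)"
proof -
  \<comment> \<open>Matrix row \<open>i\<close> belongs to position \<open>Suc i\<close>; free rows
    before the last free one stay unchanged.\<close>
  let ?c = "\<lambda>i. if Suc n - k \<le> Suc i then - 1 else 0"
  let ?f = "\<lambda>i j. magog_row m P Q (Suc n) k (Suc i) (b (Suc i)) (n - j)"
  define g where "g i j = ?f i j + (if Suc i < Suc n then ?c i * ?f (Suc i) j else 0)" for i j
  have g: "g i j = step_row m P Q n k b (Suc i) (n - j)" if "i < n" for i j
    using row_diff[OF k _ _ pos mono, of "Suc i" m P Q "n - j"] that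
    by (auto simp: g_def split: if_splits)
  have g_last: "g n j = entry m P (Suc n) (int (b (Suc n)) + int (Suc n)) 0 (n - j)" for j
  proof -
    have "\<not> Suc n \<le> Suc n - k" using k by linarith
    then show ?thesis by (simp only: g_def magog_row_def if_False less_irrefl add_0_right)
  qed
  have g_nn: "g n n = max_weight m P (Suc n) (b (Suc n))"
    unfolding g_last diff_self_eq_0 by (rule entry_last_0)
  have "magog_det m P Q (Suc n) k b = det (mat (Suc n) (Suc n) (\<lambda>(i, j). g i j))"
    unfolding magog_det_def g_def diff_Suc_1 by (rule det_add_next_row[symmetric])
  \<comment> \<open>If \<open>b (Suc n) \<le> m + n\<close>, monotonicity bounds every prescribed
    entry and the last column vanishes above the corner; otherwise the last row vanishes to its
    left.\<close>
  also have "\<dots> = g n n * det (mat n n (\<lambda>(i, j). g i j))"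
  proof (cases "b (Suc n) \<le> m + n")
    case True
    have "b j \<le> m + n" if "Suc n - k < j" "j \<le> Suc n" for j
    proof -
      from that(2) have "b j \<le> b (Suc n)"
        using that(1)
      proof (induction j rule: inc_induct)
        case (step j)
        then have "b j \<le> b (Suc j)" using mono by auto
        then show ?case using step by simp
      qed simp
      then show ?thesis using True by simp
    qed
    then show ?thesis
      by (intro det_last_col) (simp add: g step_row_0[OF k])
  next
    case False
    then show ?thesis
      by (intro det_last_row) (simp add: g_last entry_last_pos del: of_nat_Suc)
  qed
  also have "det (mat n n (\<lambda>(i, j). g i j)) =
      det (mat n n (\<lambda>(i, j). \<Sum>t\<in>step_range n k b (Suc i).
        step_weight Q n k (Suc i) t * magog_row m P Q n k (Suc i) t (n - 1 - j)))"
  proof (rule det_mat_cong)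
    fix i j
    assume "i < n" "j < n"
    \<comment> \<open>All remaining columns carry a positive power of \<open>z\<close>, so the shift
      by one applies to them.\<close>
    then have "n - j = Suc (n - 1 - j)" by simp
    then show "g i j = (\<Sum>t\<in>step_range n k b (Suc i).
        step_weight Q n k (Suc i) t * magog_row m P Q n k (Suc i) t (n - 1 - j))"
      using g[OF \<open>i < n\<close>, of j] step_row_Suc[of "Suc i" m P Q n k b "n - 1 - j"] by simp
  qed
  also have "\<dots> = (\<Sum>c\<in>PiE {1..n} (step_range n k b).
       (\<Prod>i = 1..n. step_weight Q n k i (c i)) * magog_det m P Q n k c)"
    unfolding magog_det_def
    by (rule det_sum_rows[where f = "\<lambda>i t j. magog_row m P Q n k i t (n - 1 - j)"])
       (rule finite_step_range)
  finally show ?thesis by (simp only: g_nn)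
qed

section \<open>Adding a row: the trapezoids\<close>

definition magog_gf ::
    "nat \<Rightarrow> 'a :: comm_ring_1 \<Rightarrow> 'a \<Rightarrow> nat \<Rightarrow> nat \<Rightarrow> (nat \<Rightarrow> nat) \<Rightarrow> 'a" where
  "magog_gf m P Q n k b =
    (\<Sum>M | M \<in> magog_trapezoids m n k \<and> (\<forall>j \<in> {n - k + 1..n}. M n j = b j).
       P ^ card (magog_maxima m n k M) *
       Q ^ card (magog_minima n k M - {(n, n - k + 1)}))"

section \<open>Extending and truncating arrays\<close>

lemma magog_index_Suc:
  "1 \<le> k \<Longrightarrow> (i, j) \<in> magog_index (Suc n) k \<longleftrightarrow>
     (i, j) \<in> magog_index n k \<or> i = Suc n \<and> j \<in> {Suc n - k + 1..Suc n}"
  by (auto simp: magog_index_def)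

lemma magog_index_le: "(i, j) \<in> magog_index n k \<Longrightarrow> i \<le> n"
  by (simp add: magog_index_def)

definition add_row :: "nat \<Rightarrow> nat \<Rightarrow> (nat \<Rightarrow> nat) \<Rightarrow> (nat \<Rightarrow> nat \<Rightarrow> nat) \<Rightarrow> nat \<Rightarrow> nat \<Rightarrow> nat" where
  "add_row n k b M i j =
     (if i = Suc n then if j \<in> {Suc n - k + 1..Suc n} then b j else 0 else M i j)"

definition del_row :: "nat \<Rightarrow> (nat \<Rightarrow> nat \<Rightarrow> nat) \<Rightarrow> nat \<Rightarrow> nat \<Rightarrow> nat" where
  "del_row n M i j = (if i \<le> n then M i j else 0)"

lemma add_row_last: "j \<in> {Suc n - k + 1..Suc n} \<Longrightarrow> add_row n k b M (Suc n) j = b j"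
  by (simp add: add_row_def)

lemma del_row_mem:
  assumes "1 \<le> k" and M: "M \<in> magog_trapezoids m (Suc n) k"
  shows "del_row n M \<in> magog_trapezoids m n k"
proof -
  have idx: "(i, j) \<in> magog_index (Suc n) k" "i \<le> n" if "(i, j) \<in> magog_index n k" for i j
    using that assms(1) by (simp_all add: magog_index_Suc magog_index_le)
  have old: "del_row n M i j = M i j" if "(i, j) \<in> magog_index n k" for i j
    using idx(2)[OF that] by (simp add: del_row_def)
  show ?thesis
    unfolding magog_trapezoids_def mem_Collect_eq
  proof (intro conjI allI impI)
    fix i j
    assume "(i, j) \<notin> magog_index n k"
    then have "i \<le> n \<Longrightarrow> (i, j) \<notin> magog_index (Suc n) k" using assms(1) by (simp add: magog_index_Suc)
    then show "del_row n M i j = 0" using M by (simp add: magog_trapezoids_def del_row_def)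
  next
    fix i j
    assume "(i, j) \<in> magog_index n k"
    then show "0 < del_row n M i j" "del_row n M i j \<le> m + j"
      using M idx(1) old by (simp_all add: magog_trapezoids_def)
  next
    fix i j
    assume ij: "(i, j) \<in> magog_index n k \<and> (i + 1, j) \<in> magog_index n k"
    then have "M (i + 1) j \<le> M i j"
      using M idx(1) unfolding magog_trapezoids_def by blast
    then show "del_row n M (i + 1) j \<le> del_row n M i j" using ij old by metis
  next
    fix i j
    assume ij: "(i, j) \<in> magog_index n k \<and> (i + 1, j + 1) \<in> magog_index n k"
    then have "M i j \<le> M (i + 1) (j + 1)"
      using M idx(1) unfolding magog_trapezoids_def by blast
    then show "del_row n M i j \<le> del_row n M (i + 1) (j + 1)" using ij old by metis
  qed
qed

text \<open>The new order relations say that row \<open>n\<close> interlaces with \<open>b\<close>;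
  at the left end only positivity bounds it from below. The bounds on \<open>b j\<close> for
  \<open>j \<le> n\<close> follow from \<open>b j \<le> M n j\<close>, which leaves the one on
  \<open>b (Suc n)\<close>.\<close>

lemma add_row_mem_iff:
  assumes k: "1 \<le> k" and M: "M \<in> magog_trapezoids m n k"
    and pos: "\<forall>i \<in> {Suc n - k + 1..Suc n}. 0 < b i"
  shows "add_row n k b M \<in> magog_trapezoids m (Suc n) k \<longleftrightarrow>
    b (Suc n) \<le> m + Suc n \<and> (\<forall>i \<in> {1..n}. M n i \<in> step_range n k b i)"
proof
  assume A: "add_row n k b M \<in> magog_trapezoids m (Suc n) k"
  have "(Suc n, Suc n) \<in> magog_index (Suc n) k"
    using k by (simp add: magog_index_def)
  then have "add_row n k b M (Suc n) (Suc n) \<le> m + Suc n"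
    using A unfolding magog_trapezoids_def by blast
  moreover have "Suc n \<in> {Suc n - k + 1..Suc n}" using k by auto
  ultimately have "b (Suc n) \<le> m + Suc n" by (simp only: add_row_last)
  moreover have "M n i \<in> step_range n k b i" if i: "i \<in> {1..n}" for i
  proof (cases "i \<le> n - k")
    case True
    then have "(n, i) \<notin> magog_index n k" using k by (auto simp: magog_index_def)
    then have "M n i = 0" using M by (simp add: magog_trapezoids_def)
    then show ?thesis using True by (simp add: step_range_def)
  next
    case False
    have 1: "(n, i) \<in> magog_index n k" using False i by (simp add: magog_index_def)
    then have 2: "(n, i) \<in> magog_index (Suc n) k" using k by (simp add: magog_index_Suc)
    have 3: "(n + 1, i + 1) \<in> magog_index (Suc n) k"
      using False i by (simp add: magog_index_def)
    have "add_row n k b M n i \<le> add_row n k b M (n + 1) (i + 1)"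
      using A 2 3 unfolding magog_trapezoids_def by blast
    moreover have "Suc i \<in> {Suc n - k + 1..Suc n}" using False i by auto
    ultimately have upper: "M n i \<le> b (Suc i)"
      using add_row_last[of "Suc i"] by (simp add: add_row_def del: atLeastAtMost_iff split: if_splits)
    have lower: "0 < M n i" using M 1 by (simp add: magog_trapezoids_def)
    show ?thesis
    proof (cases "i = Suc n - k")
      case True
      then show ?thesis using upper lower False by (simp add: step_range_def)
    next
      case neq: False
      then have 4: "(n + 1, i) \<in> magog_index (Suc n) k"
        using False i by (simp add: magog_index_def)
      have "add_row n k b M (n + 1) i \<le> add_row n k b M n i"
        using A 2 4 unfolding magog_trapezoids_def by blast
      moreover have "i \<in> {Suc n - k + 1..Suc n}" using neq False i by auto
      ultimately have "b i \<le> M n i"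
        using add_row_last[of i] by (simp add: add_row_def del: atLeastAtMost_iff split: if_splits)
      then show ?thesis using upper False neq by (simp add: step_range_def)
    qed
  qed
  ultimately show "b (Suc n) \<le> m + Suc n \<and> (\<forall>i \<in> {1..n}. M n i \<in> step_range n k b i)" by blast
next
  assume A: "b (Suc n) \<le> m + Suc n \<and> (\<forall>i \<in> {1..n}. M n i \<in> step_range n k b i)"
  have lower: "b j \<le> M n j" if "j \<in> {Suc n - k + 1..n}" for j
  proof -
    have "M n j \<in> step_range n k b j" using A that by auto
    then show ?thesis using that by (auto simp: step_range_def split: if_splits)
  qed
  have upper: "M n j \<le> b (Suc j)" if "(n, j) \<in> magog_index n k" for j
  proof -
    have "M n j \<in> step_range n k b j" "\<not> j \<le> n - k"
      using A that by (auto simp: magog_index_def)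
    then show ?thesis by (auto simp: step_range_def split: if_splits)
  qed
  have bound: "b j \<le> m + j" if "j \<in> {Suc n - k + 1..Suc n}" for j
  proof (cases "j = Suc n")
    case False
    then have "(n, j) \<in> magog_index n k" using that by (auto simp: magog_index_def)
    then have "M n j \<le> m + j" using M by (simp add: magog_trapezoids_def)
    moreover have "b j \<le> M n j" using lower that False by auto
    ultimately show ?thesis by simp
  qed (use A in simp)
  have idx: "(i, j) \<in> magog_index (Suc n) k \<longleftrightarrow>
     (i, j) \<in> magog_index n k \<or> i = Suc n \<and> j \<in> {Suc n - k + 1..Suc n}" for i j
    using magog_index_Suc[OF k] by blast
  have old: "add_row n k b M i j = M i j" if "(i, j) \<in> magog_index n k" for i j
    using magog_index_le[OF that] by (simp add: add_row_def)
  note new = add_row_last[of _ n k b M]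
  show "add_row n k b M \<in> magog_trapezoids m (Suc n) k"
    unfolding magog_trapezoids_def mem_Collect_eq
  proof (intro conjI allI impI)
    fix i j
    assume "(i, j) \<notin> magog_index (Suc n) k"
    then show "add_row n k b M i j = 0"
      using M unfolding idx by (auto simp: add_row_def magog_trapezoids_def)
  next
    fix i j
    assume "(i, j) \<in> magog_index (Suc n) k"
    then show "0 < add_row n k b M i j" "add_row n k b M i j \<le> m + j"
      unfolding idx using M pos bound
      by (auto simp: old new magog_trapezoids_def simp del: atLeastAtMost_iff)
  next
    fix i j
    assume ij: "(i, j) \<in> magog_index (Suc n) k \<and> (i + 1, j) \<in> magog_index (Suc n) k"
    then have 1: "(i, j) \<in> magog_index n k"
      unfolding idx by (auto dest: magog_index_le simp: magog_index_def)
    show "add_row n k b M (i + 1) j \<le> add_row n k b M i j"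
    proof (cases "i = n")
      case True
      then have "j \<in> {Suc n - k + 1..n}" using ij 1 by (auto simp: magog_index_def)
      then show ?thesis using lower old[OF 1] new[of j] True by simp
    next
      case False
      then have "(i + 1, j) \<in> magog_index n k" using ij unfolding idx by auto
      then show ?thesis using old 1 M by (simp add: magog_trapezoids_def)
    qed
  next
    fix i j
    assume ij: "(i, j) \<in> magog_index (Suc n) k \<and> (i + 1, j + 1) \<in> magog_index (Suc n) k"
    then have 1: "(i, j) \<in> magog_index n k"
      unfolding idx by (auto simp: magog_index_def)
    show "add_row n k b M i j \<le> add_row n k b M (i + 1) (j + 1)"
    proof (cases "i = n")
      case True
      then have "Suc j \<in> {Suc n - k + 1..Suc n}" using ij by (auto simp: magog_index_def)
      then show ?thesis using upper 1 old[OF 1] new[of "Suc j"] True by simp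
    next
      case False
      then have "(i + 1, j + 1) \<in> magog_index n k" using ij unfolding idx by auto
      then show ?thesis using old 1 M by (simp add: magog_trapezoids_def)
    qed
  qed
qed

lemma add_del_row:
  assumes "1 \<le> k" and "M \<in> magog_trapezoids m (Suc n) k"
    and "\<forall>j \<in> {Suc n - k + 1..Suc n}. M (Suc n) j = b j"
  shows "add_row n k b (del_row n M) = M"
proof (intro ext)
  fix i j
  have "M i j = 0" if "(i, j) \<notin> magog_index (Suc n) k"
    using assms(2) that by (simp add: magog_trapezoids_def)
  then show "add_row n k b (del_row n M) i j = M i j"
    using assms(3) magog_index_Suc[OF assms(1), of i j n] magog_index_le[of i j n k]
    by (auto simp: add_row_def del_row_def)
qed

lemma del_add_row:
  assumes "M \<in> magog_trapezoids m n k"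
  shows "del_row n (add_row n k b M) = M"
proof (intro ext)
  fix i j
  have "M i j = 0" if "n < i"
    using assms that magog_index_le[of i j n k] by (auto simp: magog_trapezoids_def)
  then show "del_row n (add_row n k b M) i j = M i j"
    by (auto simp: add_row_def del_row_def)
qed

text \<open>Only \<open>(Suc n, Suc n)\<close> can become a new maximum, and the bound on
  \<open>b (Suc n)\<close> excludes the case of weight 0.\<close>

lemma maxima_add_row:
  assumes k: "1 \<le> k" and b: "b (Suc n) \<le> m + Suc n"
  shows "P ^ card (magog_maxima m (Suc n) k (add_row n k b M)) =
    max_weight m P (Suc n) (b (Suc n)) * P ^ card (magog_maxima m n k M)"
proof -
  have idx: "(i, i) \<in> magog_index (Suc n) k \<longleftrightarrow> (i, i) \<in> magog_index n k \<or> i = Suc n" for i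
    using k by (auto simp: magog_index_def)
  have "magog_maxima m (Suc n) k (add_row n k b M) =
      magog_maxima m n k M \<union> (if b (Suc n) = m + Suc n then {(Suc n, Suc n)} else {})"
    using k by (auto simp: magog_maxima_def idx add_row_def dest: magog_index_le)
  moreover have "(Suc n, Suc n) \<notin> magog_maxima m n k M"
    by (auto simp: magog_maxima_def magog_index_def)
  moreover have "finite (magog_maxima m n k M)"
    by (rule finite_subset[OF _ finite_magog_index[of n k]]) (auto simp: magog_maxima_def)
  ultimately show ?thesis using b by (auto simp: max_weight_def)
qed

text \<open>The new left end is excluded from the count, while the former one,
  \<open>(n, n - k + 1)\<close>, is now included; the product of weights is \<open>Q\<close> exactly
  if that entry exists and equals 1.\<close>

lemma minima_add_row:
  assumes k: "1 \<le> k" and c: "\<And>i. i \<in> {1..n} \<Longrightarrow> c i = M n i"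
  shows "Q ^ card (magog_minima (Suc n) k (add_row n k b M) - {(Suc n, Suc n - k + 1)}) =
    (\<Prod>i = 1..n. step_weight Q n k i (c i)) *
    Q ^ card (magog_minima n k M - {(n, n - k + 1)})"
proof -
  let ?A = "magog_minima n k M - {(n, n - k + 1)}"
  have "(i, j) \<in> magog_minima (Suc n) k (add_row n k b M) - {(Suc n, Suc n - k + 1)} \<longleftrightarrow>
      (i, j) \<in> magog_minima n k M" for i j
    using k by (auto simp: magog_minima_def magog_index_Suc add_row_def dest: magog_index_le)
  then have 1: "magog_minima (Suc n) k (add_row n k b M) - {(Suc n, Suc n - k + 1)} =
      magog_minima n k M"
    by auto
  have fin: "finite (magog_minima n k M)"
    by (rule finite_subset[OF _ finite_magog_index[of n k]]) (auto simp: magog_minima_def)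
  show ?thesis
  proof (cases "k \<le> n \<and> M n (n - k + 1) = 1")
    case True
    then have "(n, n - k + 1) \<in> magog_minima n k M"
      using k by (auto simp: magog_minima_def magog_index_def)
    then have "card (magog_minima n k M) = Suc (card ?A)"
      by (rule card_Suc_Diff1[OF fin, symmetric])
    moreover have "(\<Prod>i = 1..n. step_weight Q n k i (c i)) = Q"
    proof -
      have "(\<Prod>i = 1..n. step_weight Q n k i (c i)) = (\<Prod>i = 1..n. if i = Suc n - k then Q else 1)"
        using True c by (intro prod.cong) (auto simp: step_weight_def Suc_diff_le)
      then show ?thesis using True k by (auto simp: prod.delta)
    qed
    ultimately show ?thesis unfolding 1 by simp
  next
    case False
    then have "(n, n - k + 1) \<notin> magog_minima n k M"
      using k by (auto simp: magog_minima_def magog_index_def)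
    then have "?A = magog_minima n k M" by blast
    moreover have "(\<Prod>i = 1..n. step_weight Q n k i (c i)) = 1"
    proof (rule prod.neutral, rule ballI)
      fix i
      assume i: "i \<in> {1..n}"
      have "\<not> (i = Suc n - k \<and> c i = 1)"
      proof
        assume *: "i = Suc n - k \<and> c i = 1"
        then have "k \<le> n" using i by auto
        then have "i = n - k + 1" using * by (simp add: Suc_diff_le)
        then show False using False * c[OF i] \<open>k \<le> n\<close> by auto
      qed
      then show "step_weight Q n k i (c i) = 1" by (auto simp: step_weight_def)
    qed
    ultimately show ?thesis unfolding 1 by simp
  qed
qed

lemma magog_gf_Suc:
  fixes P Q :: "'a :: comm_ring_1"
  assumes k: "1 \<le> k" and pos: "\<forall>i \<in> {Suc n - k + 1..Suc n}. 0 < b i"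
  shows "magog_gf m P Q (Suc n) k b = max_weight m P (Suc n) (b (Suc n)) *
    (\<Sum>c\<in>PiE {1..n} (step_range n k b).
       (\<Prod>i = 1..n. step_weight Q n k i (c i)) * magog_gf m P Q n k c)"
proof -
  define T where "T l b = {M \<in> magog_trapezoids m l k. \<forall>j \<in> {l - k + 1..l}. M l j = b j}" for l b
  define w where "w l M = P ^ card (magog_maxima m l k M) *
      Q ^ card (magog_minima l k M - {(l, l - k + 1)})" for l M
  have gf: "magog_gf m P Q l k b = sum (w l) (T l b)" for l b
    unfolding magog_gf_def T_def w_def ..
  have finT: "finite (T l b)" for l b
    unfolding T_def using finite_magog_trapezoids[of m l k] by (rule rev_finite_subset) auto
  show ?thesis
  proof (cases "b (Suc n) \<le> m + Suc n")
    case False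
    \<comment> \<open>Here the right side is 0 through \<open>max_weight\<close>.\<close>
    have "T (Suc n) b = {}"
    proof (rule ccontr)
      assume "T (Suc n) b \<noteq> {}"
      then obtain M where M: "M \<in> magog_trapezoids m (Suc n) k" "M (Suc n) (Suc n) = b (Suc n)"
        using k unfolding T_def by fastforce
      have "(Suc n, Suc n) \<in> magog_index (Suc n) k"
        using k by (simp add: magog_index_def)
      then have "M (Suc n) (Suc n) \<le> m + Suc n" using M(1) unfolding magog_trapezoids_def by blast
      then show False using M(2) False by simp
    qed
    then show ?thesis using False by (simp add: gf max_weight_def)
  next
    case True
    let ?C = "PiE {1..n} (step_range n k b)"
    have "sum (w (Suc n)) (T (Suc n) b) =
        (\<Sum>(c, M)\<in>(SIGMA c:?C. T n c). max_weight m P (Suc n) (b (Suc n)) *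
           ((\<Prod>i = 1..n. step_weight Q n k i (c i)) * w n M))"
    \<comment> \<open>A trapezoid corresponds to its row \<open>n\<close> together with the array
      above the bottom row; \<open>restrict\<close> makes that row extensional, as
      \<open>PiE\<close> demands.\<close>
    proof (rule sum.reindex_bij_witness[where j = "\<lambda>M. (restrict (M n) {1..n}, del_row n M)"
          and i = "\<lambda>(c, M). add_row n k b M"])
      fix M
      assume M: "M \<in> T (Suc n) b"
      then have M_eq: "add_row n k b (del_row n M) = M"
        using add_del_row[OF k] unfolding T_def by blast
      then show "(case (restrict (M n) {1..n}, del_row n M) of (c, M) \<Rightarrow> add_row n k b M) = M" by simp
      have del: "del_row n M \<in> magog_trapezoids m n k"
        using M del_row_mem[OF k] unfolding T_def by blast
      have "\<forall>i \<in> {1..n}. M n i \<in> step_range n k b i"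
        using add_row_mem_iff[OF k del pos] M unfolding M_eq T_def by (simp add: del_row_def)
      then show "(restrict (M n) {1..n}, del_row n M) \<in> (SIGMA c:?C. T n c)"
        using del by (auto simp: T_def del_row_def)
      show "(case (restrict (M n) {1..n}, del_row n M) of (c, M) \<Rightarrow>
          max_weight m P (Suc n) (b (Suc n)) * ((\<Prod>i = 1..n. step_weight Q n k i (c i)) * w n M)) =
          w (Suc n) M"
        using maxima_add_row[of k b n m P "del_row n M", OF k True]
          minima_add_row[of k n "restrict (M n) {1..n}" "del_row n M" Q b, OF k]
        unfolding M_eq w_def by (simp add: del_row_def mult_ac)
    next
      fix p
      assume "p \<in> (SIGMA c:?C. T n c)"
      then obtain c M where p: "p = (c, M)" and c: "c \<in> ?C" and M: "M \<in> T n c" by blast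
      have M': "M \<in> magog_trapezoids m n k" using M by (simp add: T_def)
      \<comment> \<open>\<open>T n c\<close> prescribes only the positions beyond
        \<open>n - k\<close>; on the others both values are 0, by the normalisation of arrays and by
        \<open>step_range\<close>.\<close>
      have cM: "M n i = c i" if i: "i \<in> {1..n}" for i
      proof (cases "i \<le> n - k")
        case True
        then have "(n, i) \<notin> magog_index n k" using k by (auto simp: magog_index_def)
        then have "M n i = 0" using M' by (simp add: magog_trapezoids_def)
        moreover have "c i \<in> step_range n k b i" using c i by auto
        ultimately show ?thesis using True by (simp add: step_range_def)
      qed (use M i in \<open>simp add: T_def\<close>)
      then have "restrict (M n) {1..n} = c"
        using c by (auto simp: fun_eq_iff PiE_def extensional_def)
      moreover have "add_row n k b M n = M n" by (simp add: add_row_def fun_eq_iff)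
      ultimately show "(\<lambda>M. (restrict (M n) {1..n}, del_row n M)) (case p of (c, M) \<Rightarrow> add_row n k b M) = p"
        by (simp add: p del_add_row[OF M'])
      have "\<forall>i \<in> {1..n}. M n i \<in> step_range n k b i" using cM c by auto
      then have "add_row n k b M \<in> magog_trapezoids m (Suc n) k"
        using add_row_mem_iff[OF k M' pos] True by blast
      then show "(case p of (c, M) \<Rightarrow> add_row n k b M) \<in> T (Suc n) b"
        by (simp add: p T_def add_row_def)
    qed
    also have "\<dots> = (\<Sum>c\<in>?C. \<Sum>M\<in>T n c. max_weight m P (Suc n) (b (Suc n)) *
           ((\<Prod>i = 1..n. step_weight Q n k i (c i)) * w n M))"
      by (rule sum.Sigma[symmetric]) (auto intro!: finite_PiE simp: finite_step_range finT)
    finally show ?thesis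
      by (simp add: gf sum_distrib_left)
  qed
qed

text \<open>Both sides obey the same recursion, and the hypotheses pass on to every admissible row
  \<open>c\<close>. At \<open>n = 0\<close> there is one empty array and an empty determinant, both
  of value 1.\<close>

lemma magog_gf_eq_magog_det:
  assumes k: "1 \<le> k"
    and "\<forall>i \<in> {n - k + 1..n}. 0 < b i" and "\<forall>i \<in> {n - k + 1..<n}. b i \<le> b (Suc i)"
  shows "magog_gf m P Q n k b = magog_det m P Q n k b"
  using assms(2,3)
proof (induction n arbitrary: b)
  case 0
  have idx: "magog_index 0 k = {}" by (auto simp: magog_index_def)
  then have "magog_trapezoids m 0 k = {\<lambda>_ _. 0}"
    by (auto simp: magog_trapezoids_def fun_eq_iff)
  moreover have "{M. M \<in> magog_trapezoids m 0 k \<and> (\<forall>j \<in> {0 - k + 1..0}. M 0 j = b j)} =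
      magog_trapezoids m 0 k"
    by auto
  ultimately have "magog_gf m P Q 0 k b = 1"
    unfolding magog_gf_def by (simp add: magog_maxima_def magog_minima_def idx)
  then show ?case by (simp add: magog_det_def)
next
  case (Suc n)
  have "magog_gf m P Q n k c = magog_det m P Q n k c" if c: "c \<in> PiE {1..n} (step_range n k b)" for c
  proof (rule Suc.IH)
    have range: "c i \<in> step_range n k b i" if "i \<in> {n - k + 1..n}" for i
      using c that by auto
    show "\<forall>i \<in> {n - k + 1..n}. 0 < c i"
    proof
      fix i
      assume i: "i \<in> {n - k + 1..n}"
      have "0 < b i" if "i \<noteq> Suc n - k"
        using Suc.prems(1) i that by auto
      then show "0 < c i" using range[OF i] i by (auto simp: step_range_def split: if_splits)
    qed
    show "\<forall>i \<in> {n - k + 1..<n}. c i \<le> c (Suc i)"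
    proof
      fix i
      assume i: "i \<in> {n - k + 1..<n}"
      \<comment> \<open>Consecutive entries of \<open>c\<close> are separated by
        \<open>b (Suc i)\<close>: position \<open>Suc i\<close> lies beyond the left end, so its
        range starts there.\<close>
      have "c i \<le> b (Suc i)"
        using range[of i] i by (auto simp: step_range_def split: if_splits)
      also have "b (Suc i) \<le> c (Suc i)"
        using range[of "Suc i"] i by (auto simp: step_range_def split: if_splits)
      finally show "c i \<le> c (Suc i)" .
    qed
  qed
  then show ?case
    by (simp add: magog_gf_Suc[OF k Suc.prems(1)] magog_det_Suc[OF k Suc.prems])
qed


section \<open>The constant term formula\<close>

theorem theorem4p1:
  fixes m n k :: nat and b :: "nat \<Rightarrow> nat" and P Q :: "'a :: comm_ring_1"
    and x :: "nat \<Rightarrow> 'a mfls"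
  defines "x \<equiv> mfls_var"
  assumes "1 \<le> k" and "k \<le> n"
    and "\<forall>i \<in> {n - k + 1..n}. 0 < b i"
    and "\<forall>i \<in> {n - k + 1..<n}. b i \<le> b (i + 1)"
  shows "(\<Sum>M | M \<in> magog_trapezoids m n k \<and> (\<forall>j \<in> {n - k + 1..n}. M n j = b j).
            P ^ card (magog_maxima m n k M) *
            Q ^ card (magog_minima n k M - {(n, n - k + 1)}))
       = const_term
          ((-1) powi ((int m - 1) * int n + int ((n + 1) choose 2) + (\<Sum>i = n - k + 1..n. int (b i))) *
           (\<Prod>i = 1..n - k.
              (1 + x i) powi (- int i - int k) *
              x i powi (- int m - 2 * int n + int i + 1) *
              (x i - mfls_const P * (1 + x i)) *
              (x i - mfls_const Q * (1 + x i))) *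
           (\<Prod>i = n - k + 1..n.
              (1 + x i) powi (- int n) *
              x i powi (- int m - 2 * int n + int (b i) + int i) *
              (x i - mfls_const P * (1 + x i))) *
           (\<Prod>(i, j) \<in> {(i, j). 1 \<le> i \<and> i < j \<and> j \<le> n}.
              (x i - x j) * (x i + x j + x i * x j)))"
proof -
  have "magog_gf m P Q n k b = magog_det m P Q n k b"
    using assms by (intro magog_gf_eq_magog_det) simp_all
  then show ?thesis
    unfolding x_def const_term_eq_magog_det[OF assms(2,3)] magog_gf_def .
qed

end
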